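(* For all $k\ge 1$, $$J_{12\dots k}(x)=\frac{x}{U_k\left(\frac{1}{2x}\right)}\sum_{j=1}^{k-2}U_j\left(\frac{1}{2x}\right),$$ where $J_{12\dots k}(x)=\sum_{n\ge0}J_{12\dots k}(n)x^n$ and $J_{12\dots k}(n)$ is the number of involutions in $S_n$ that avoid $12\dots k$ and contain $132$ exactly once (an empty sum being $0$).
   Context: $S_n$ is the set of permutations of $\{1,\dots,n\}$. An occurrence of a pattern $\tau\in S_k$ in $\alpha\in S_n$ is a choice of indices $1\le i_1<\dots<i_k\le n$ such that $(\alpha_{i_1},\dots,\alpha_{i_k})$ is order-isomorphic to $\tau$; $\alpha$ avoids $\tau$ if it has no occurrence, and contains $\tau$ exactly once if it has exactly one occurrence. An involution is a permutation equal to its own inverse. $U_r$ denotes the Chebyshev polynomial of the second kind, $U_r(\cos\theta)=\sin((r+1)\theta)/\sin\theta$. The identity is one of rational functions, expanded as power series in $x$. *)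

theory Defs
  imports
    Complex_Main
    "HOL-Library.FuncSet"
    "HOL-Combinatorics.Combinatorics"
    "HOL-Computational_Algebra.Computational_Algebra"
begin

text \<open>
  An element of \<open>S\<^sub>n\<close> is a function that permutes \<open>{1..n}\<close>. An occurrence of \<open>\<tau>\<close> (in \<open>S\<^sub>k\<close>) is
  given by its increasing index sequence \<open>i 1 < \<dots> < i k\<close>; the sequence is extensional outside
  \<open>{1..k}\<close>, so that occurrences are counted correctly by \<open>card\<close>.
\<close>

definition occurrences :: "nat \<Rightarrow> (nat \<Rightarrow> nat) \<Rightarrow> nat \<Rightarrow> (nat \<Rightarrow> nat) \<Rightarrow> (nat \<Rightarrow> nat) set" where
  "occurrences k \<tau> n \<alpha> =
     {i \<in> {1..k} \<rightarrow>\<^sub>E {1..n}. strict_mono_on {1..k} i \<and>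
        (\<forall>a\<in>{1..k}. \<forall>b\<in>{1..k}. \<alpha> (i a) < \<alpha> (i b) \<longleftrightarrow> \<tau> a < \<tau> b)}"

definition avoids :: "nat \<Rightarrow> (nat \<Rightarrow> nat) \<Rightarrow> nat \<Rightarrow> (nat \<Rightarrow> nat) \<Rightarrow> bool" where
  "avoids k \<tau> n \<alpha> \<longleftrightarrow> occurrences k \<tau> n \<alpha> = {}"

definition contains_exactly_once :: "nat \<Rightarrow> (nat \<Rightarrow> nat) \<Rightarrow> nat \<Rightarrow> (nat \<Rightarrow> nat) \<Rightarrow> bool" where
  "contains_exactly_once k \<tau> n \<alpha> \<longleftrightarrow> card (occurrences k \<tau> n \<alpha>) = 1"

definition pattern_132 :: "nat \<Rightarrow> nat" where
  "pattern_132 = transpose 2 3"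

lemma pattern_132_one_line: "map pattern_132 [1, 2, 3] = [1, 3, 2]"
  by (simp add: pattern_132_def transpose_def)

lemma pattern_132_permutes: "pattern_132 permutes {1..3}"
  unfolding pattern_132_def by (rule permutes_swap_id) auto

text \<open>The pattern \<open>12\<dots>k\<close> is the identity of \<open>S\<^sub>k\<close>.\<close>

definition J_count :: "nat \<Rightarrow> nat \<Rightarrow> nat" where
  "J_count k n = card {\<alpha>. \<alpha> permutes {1..n} \<and> inv \<alpha> = \<alpha> \<and>
     avoids k id n \<alpha> \<and> contains_exactly_once 3 pattern_132 n \<alpha>}"

definition J_gf :: "nat \<Rightarrow> real fps" where
  "J_gf k = Abs_fps (\<lambda>n. real (J_count k n))"

definition Cheb_U :: "nat \<Rightarrow> real poly" where
  "Cheb_U r = (THE p. \<forall>\<theta>. sin \<theta> \<noteq> 0 \<longrightarrow> poly p (cos \<theta>) = sin (real (r + 1) * \<theta>) / sin \<theta>)"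

lemma Cheb_U_exists:
  "\<exists>p::real poly. \<forall>\<theta>. sin \<theta> \<noteq> 0 \<longrightarrow> poly p (cos \<theta>) = sin (real (r + 1) * \<theta>) / sin \<theta>"
proof (induction r rule: less_induct)
  case (less r)
  consider "r = 0" | "r = 1" | s where "r = Suc (Suc s)"
    by (metis One_nat_def not0_implies_Suc)
  then show ?case
  proof cases
    case 1
    then show ?thesis by (intro exI[of _ 1]) auto
  next
    case 2
    then show ?thesis by (intro exI[of _ "[:0, 2:]"]) (auto simp: sin_double)
  next
    case 3
    obtain p :: "real poly" where
      p: "\<And>\<theta>. sin \<theta> \<noteq> 0 \<Longrightarrow> poly p (cos \<theta>) = sin (real (s + 1) * \<theta>) / sin \<theta>"
      using less.IH[of s] 3 by auto
    obtain q :: "real poly" where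
      q: "\<And>\<theta>. sin \<theta> \<noteq> 0 \<Longrightarrow> poly q (cos \<theta>) = sin (real (s + 2) * \<theta>) / sin \<theta>"
      using less.IH[of "Suc s"] 3 by auto
    have rec: "sin (real (s + 3) * \<theta>) = 2 * cos \<theta> * sin (real (s + 2) * \<theta>) - sin (real (s + 1) * \<theta>)"
      for \<theta> :: real
    proof -
      have "real (s + 3) * \<theta> = real (s + 2) * \<theta> + \<theta>" "real (s + 1) * \<theta> = real (s + 2) * \<theta> - \<theta>"
        by (simp_all add: algebra_simps)
      then show ?thesis by (simp only: sin_add sin_diff) simp
    qed
    have "poly ([:0, 2:] * q - p) (cos \<theta>) = sin (real (r + 1) * \<theta>) / sin \<theta>" if "sin \<theta> \<noteq> 0" for \<theta>
    proof -
      have "real (r + 1) = real (s + 3)" using 3 by simp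
      then show ?thesis
        using p[OF that] q[OF that] rec[of \<theta>]
        by (simp only:) (simp add: diff_divide_distrib)
    qed
    then show ?thesis by blast
  qed
qed

lemma Cheb_U_unique:
  fixes p q :: "real poly"
  assumes p: "\<forall>\<theta>. sin \<theta> \<noteq> 0 \<longrightarrow> poly p (cos \<theta>) = sin (real (r + 1) * \<theta>) / sin \<theta>"
    and q: "\<forall>\<theta>. sin \<theta> \<noteq> 0 \<longrightarrow> poly q (cos \<theta>) = sin (real (r + 1) * \<theta>) / sin \<theta>"
  shows "p = q"
proof (rule ccontr)
  assume "p \<noteq> q"
  then have "finite {x. poly (p - q) x = 0}" by (intro poly_roots_finite) simp
  moreover have "{-1<..<1} \<subseteq> {x. poly (p - q) x = 0}"
  proof
    fix x :: real assume x: "x \<in> {-1<..<1}"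
    then have "sin (arccos x) \<noteq> 0" "cos (arccos x) = x"
      using sin_arccos_nonzero[of x] by auto
    then show "x \<in> {x. poly (p - q) x = 0}"
      using p[rule_format, of "arccos x"] q[rule_format, of "arccos x"] by simp
  qed
  ultimately have "finite {-1<..<1::real}" by (rule rev_finite_subset)
  then show False using infinite_Ioo[of "-1::real" 1] by simp
qed

lemma poly_Cheb_U_cos:
  assumes "sin \<theta> \<noteq> 0"
  shows "poly (Cheb_U r) (cos \<theta>) = sin (real (r + 1) * \<theta>) / sin \<theta>"
proof -
  have "\<exists>!p::real poly. \<forall>\<theta>. sin \<theta> \<noteq> 0 \<longrightarrow> poly p (cos \<theta>) = sin (real (r + 1) * \<theta>) / sin \<theta>"
    using Cheb_U_exists Cheb_U_unique by (rule ex_ex1I)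
  from theI'[OF this] show ?thesis using assms unfolding Cheb_U_def by blast
qed

text \<open>
  Rational functions in \<open>x\<close> are viewed inside the field of formal Laurent series (their expansion
  at \<open>x = 0\<close>), where \<open>1/(2x)\<close> can be substituted into a polynomial.
\<close>

definition U_at :: "nat \<Rightarrow> real fls" where
  "U_at r = poly (map_poly fls_const (Cheb_U r)) (1 / (2 * fls_X))"

end

theory Submission
  imports Defs
begin

text \<open>
  Split a 132-avoiding permutation at its maximum: everything to the left exceeds everything to the
  right, so it is a skew sum of \<open>\<sigma>\<close> and \<open>\<rho>\<close>, where \<open>\<sigma>\<close> ends with its maximum. Removing that maximum
  lowers by one the length of the longest increasing subsequence. Hence the generating functions
  satisfy \<open>C\<^sub>k = 1 + x C\<^sub>k\<^sub>-\<^sub>1 C\<^sub>k\<close>.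

  Now let \<open>\<alpha>\<close> be an involution of \<open>{1..n}\<close> with exactly one 132. If \<open>\<alpha> n = n\<close>, delete \<open>n\<close>. If
  \<open>\<alpha> n < n\<close> and \<open>n\<close> is not in the occurrence, then \<open>\<alpha>\<close> is a skew sum of \<open>\<sigma>\<close>, \<open>\<tau>\<close> and \<open>\<sigma>\<inverse>\<close>, where \<open>\<sigma>\<close>
  avoids 132 and ends with its maximum, and \<open>\<tau>\<close> is again an involution with one 132. If \<open>n\<close> is in the
  occurrence, then \<open>n = 2p + 1\<close>, \<open>p\<close> is a fixed point, \<open>p + 1\<close> and \<open>n\<close> are swapped, and conjugation by
  \<open>(p p+1)\<close> turns \<open>\<alpha>\<close> into the skew sum of \<open>\<sigma>\<close>, a point, and \<open>\<sigma>\<inverse>\<close>. For \<open>k \<ge> 3\<close> this gives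
  \<open>J\<^sub>k = x J\<^sub>k\<^sub>-\<^sub>1 + x\<^sup>2 C\<^sub>k\<^sub>-\<^sub>1(x\<^sup>2) J\<^sub>k + x\<^sup>3 C\<^sub>k\<^sub>-\<^sub>1(x\<^sup>2)\<close>.

  With \<open>U\<^sub>r\<close> evaluated at \<open>1/(2x)\<close>, the recurrence for \<open>C\<^sub>k\<close> yields \<open>x U\<^sub>k C\<^sub>k(x\<^sup>2) = U\<^sub>k\<^sub>-\<^sub>1\<close>, and the one for
  \<open>J\<^sub>k\<close> becomes \<open>U\<^sub>k J\<^sub>k = U\<^sub>k\<^sub>-\<^sub>1 J\<^sub>k\<^sub>-\<^sub>1 + x U\<^sub>k\<^sub>-\<^sub>2\<close>, which telescopes.
\<close>

subsection \<open>132-triples and increasing subsets\<close>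

text \<open>Positions range over an arbitrary set \<open>A\<close>, so that a block of a
  permutation, even one with a hole such as \<open>{1..p + 1} - {p}\<close>, can be counted in
  place.\<close>

definition occ :: "(nat \<Rightarrow> nat) \<Rightarrow> nat set \<Rightarrow> (nat \<times> nat \<times> nat) set" where
  "occ f A = {(a, b, c). a \<in> A \<and> b \<in> A \<and> c \<in> A \<and> a < b \<and> b < c \<and> f a < f c \<and> f c < f b}"

definition inc :: "nat \<Rightarrow> (nat \<Rightarrow> nat) \<Rightarrow> nat set \<Rightarrow> bool" where
  "inc k f A \<longleftrightarrow> (\<exists>S\<subseteq>A. finite S \<and> card S = k \<and> strict_mono_on S f)"

lemma finite_occ: "finite A \<Longrightarrow> finite (occ f A)"
  by (rule finite_subset[of _ "A \<times> A \<times> A"]) (auto simp: occ_def)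

lemma occ_cong:
  assumes "\<And>x y. x \<in> A \<Longrightarrow> y \<in> A \<Longrightarrow> f x < f y \<longleftrightarrow> g x < g y"
  shows "occ f A = occ g A"
  using assms unfolding occ_def by auto

lemma inc_cong:
  assumes "\<And>x y. x \<in> A \<Longrightarrow> y \<in> A \<Longrightarrow> f x < f y \<longleftrightarrow> g x < g y"
  shows "inc k f A = inc k g A"
proof -
  have "strict_mono_on S f \<longleftrightarrow> strict_mono_on S g" if "S \<subseteq> A" for S
    using assms that unfolding strict_mono_on_def by (meson subsetD)
  then show ?thesis unfolding inc_def by blast
qed

text \<open>An increasing relabelling of positions carries triples over componentwise; this
  renumbers a block so that it starts at 1.\<close>

lemma card_occ_image:
  assumes h: "strict_mono_on A h"
  shows "card (occ f (h ` A)) = card (occ (f \<circ> h) A)"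
proof -
  have inj: "inj_on h A" using h by (rule strict_mono_on_imp_inj_on)
  have less: "h x < h y \<longleftrightarrow> x < y" if "x \<in> A" "y \<in> A" for x y
    using h that by (simp add: strict_mono_on_less)
  have "bij_betw (\<lambda>(a, b, c). (h a, h b, h c)) (occ (f \<circ> h) A) (occ f (h ` A))"
    unfolding bij_betw_def
  proof
    show "inj_on (\<lambda>(a, b, c). (h a, h b, h c)) (occ (f \<circ> h) A)"
      using inj by (auto simp: inj_on_def occ_def)
    show "(\<lambda>(a, b, c). (h a, h b, h c)) ` occ (f \<circ> h) A = occ f (h ` A)"
    proof
      show "(\<lambda>(a, b, c). (h a, h b, h c)) ` occ (f \<circ> h) A \<subseteq> occ f (h ` A)"
        using less by (auto simp: occ_def)
      show "occ f (h ` A) \<subseteq> (\<lambda>(a, b, c). (h a, h b, h c)) ` occ (f \<circ> h) A"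
      proof (clarify)
        fix a' b' c' assume *: "(a', b', c') \<in> occ f (h ` A)"
        then obtain a b c where "a' = h a" "b' = h b" "c' = h c" "a \<in> A" "b \<in> A" "c \<in> A"
          by (auto simp: occ_def)
        then show "(a', b', c') \<in> (\<lambda>(a, b, c). (h a, h b, h c)) ` occ (f \<circ> h) A"
          using * less by (intro image_eqI[of _ _ "(a, b, c)"]) (auto simp: occ_def)
      qed
    qed
  qed
  then show ?thesis by (metis bij_betw_same_card)
qed

lemma inc_image:
  assumes h: "strict_mono_on A h"
  shows "inc k f (h ` A) = inc k (f \<circ> h) A"
proof
  have inj: "inj_on h A" using h by (rule strict_mono_on_imp_inj_on)
  have less: "h x < h y \<longleftrightarrow> x < y" if "x \<in> A" "y \<in> A" for x y
    using h that by (simp add: strict_mono_on_less)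
  {
    assume "inc k f (h ` A)"
    then obtain S where S: "S \<subseteq> h ` A" "finite S" "card S = k" "strict_mono_on S f"
      by (auto simp: inc_def)
    then obtain T where T: "T \<subseteq> A" "S = h ` T" by (auto simp: subset_image_iff)
    have injT: "inj_on h T" using inj T inj_on_subset by blast
    have "finite T" "card T = k" using S T injT by (auto simp: finite_image_iff card_image)
    moreover have "strict_mono_on T (f \<circ> h)"
      using S(4) T less by (auto simp: strict_mono_on_def subset_iff)
    ultimately show "inc k (f \<circ> h) A" using T unfolding inc_def by blast
  }
  {
    assume "inc k (f \<circ> h) A"
    then obtain T where T: "T \<subseteq> A" "finite T" "card T = k" "strict_mono_on T (f \<circ> h)"
      by (auto simp: inc_def)
    have injT: "inj_on h T" using inj T inj_on_subset by blast
    have "finite (h ` T)" "card (h ` T) = k" using T injT by (auto simp: card_image)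
    moreover have "strict_mono_on (h ` T) f"
      using T less by (auto simp: strict_mono_on_def subset_iff)
    moreover have "h ` T \<subseteq> h ` A" using T(1) by (rule image_mono)
    ultimately show "inc k f (h ` A)" unfolding inc_def by blast
  }
qed

text \<open>The first entry of a 132 lies to the left of and below the other two. If it is in
  \<open>X\<close>, an entry in \<open>Y\<close> would be below it; if it is in \<open>Y\<close>, an
  entry in \<open>X\<close> would be left of it.\<close>

lemma occ_antitone_union:
  assumes "\<And>x y. x \<in> X \<Longrightarrow> y \<in> Y \<Longrightarrow> x < y \<and> f y < f x"
  shows "occ f (X \<union> Y) = occ f X \<union> occ f Y"
proof -
  have "{a, b, c} \<subseteq> X \<or> {a, b, c} \<subseteq> Y" if "(a, b, c) \<in> occ f (X \<union> Y)" for a b c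
    using that assms[of a b] assms[of a c] assms[of b a] assms[of b c] assms[of c a] assms[of c b]
    by (auto simp: occ_def)
  then show ?thesis by (fastforce simp: occ_def)
qed

lemma card_occ_antitone_union:
  assumes "\<And>x y. x \<in> X \<Longrightarrow> y \<in> Y \<Longrightarrow> x < y \<and> f y < f x" "finite X" "finite Y"
  shows "card (occ f (X \<union> Y)) = card (occ f X) + card (occ f Y)"
proof -
  have "occ f X \<inter> occ f Y = {}" using assms(1) by (fastforce simp: occ_def)
  then show ?thesis
    using assms by (simp add: occ_antitone_union card_Un_disjoint finite_occ)
qed

lemma inc_antitone_union:
  assumes "\<And>x y. x \<in> X \<Longrightarrow> y \<in> Y \<Longrightarrow> x < y \<and> f y < f x"
  shows "inc k f (X \<union> Y) \<longleftrightarrow> inc k f X \<or> inc k f Y"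
proof
  assume "inc k f (X \<union> Y)"
  then obtain S where S: "S \<subseteq> X \<union> Y" "finite S" "card S = k" "strict_mono_on S f"
    by (auto simp: inc_def)
  have "S \<subseteq> X \<or> S \<subseteq> Y"
  proof (rule ccontr)
    assume "\<not> (S \<subseteq> X \<or> S \<subseteq> Y)"
    then obtain x y where xy: "x \<in> S" "y \<in> S" "x \<in> X" "y \<in> Y" using S(1) by blast
    then have "x < y" "f y < f x" using assms by auto
    with strict_mono_onD[OF S(4) xy(1,2)] show False by simp
  qed
  then show "inc k f X \<or> inc k f Y" using S by (auto simp: inc_def)
next
  assume "inc k f X \<or> inc k f Y"
  then show "inc k f (X \<union> Y)" unfolding inc_def by blast
qed

text \<open>The last position could only be the third entry of a 132, but that entry is not the
  largest.\<close>

lemma occ_fixed_max: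
  assumes "f permutes {1..m}" "f m = m"
  shows "occ f {1..m} = occ f {1..m - 1}"
proof -
  have "c < m" if "(a, b, c) \<in> occ f {1..m}" for a b c
  proof -
    have "f b \<le> m" using permutes_in_image[OF assms(1), of b] that by (auto simp: occ_def)
    then have "c \<noteq> m" using that assms(2) by (auto simp: occ_def)
    then show ?thesis using that by (auto simp: occ_def)
  qed
  then show ?thesis by (fastforce simp: occ_def)
qed

lemma inc_fixed_max:
  assumes "f permutes {1..m}" "f m = m" "m \<ge> 1"
  shows "inc (Suc k) f {1..m} \<longleftrightarrow> inc k f {1..m - 1}"
proof
  assume "inc (Suc k) f {1..m}"
  then obtain S where S: "S \<subseteq> {1..m}" "finite S" "card S = Suc k" "strict_mono_on S f"
    by (auto simp: inc_def)
  have "S \<noteq> {}" using S by auto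
  have "x \<le> m - 1" if "x \<in> S" "x \<noteq> Max S" for x
  proof -
    have "x < Max S" using that S by (simp add: le_neq_implies_less)
    moreover have "Max S \<le> m" using S \<open>S \<noteq> {}\<close> by (metis Max_in atLeastAtMost_iff subsetD)
    ultimately show ?thesis by simp
  qed
  \<comment> \<open>Dropping \<open>Max S\<close> instead of \<open>m\<close> also covers sets
    \<open>S\<close> that do not contain \<open>m\<close>.\<close>
  then have "S - {Max S} \<subseteq> {1..m - 1}" using S(1) by (fastforce simp: subset_iff)
  moreover have "card (S - {Max S}) = k" using S \<open>S \<noteq> {}\<close> by simp
  moreover have "strict_mono_on (S - {Max S}) f" using S(4) by (auto simp: strict_mono_on_def)
  ultimately show "inc k f {1..m - 1}" using S(2) unfolding inc_def by blast
next
  assume "inc k f {1..m - 1}"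
  then obtain S where S: "S \<subseteq> {1..m - 1}" "finite S" "card S = k" "strict_mono_on S f"
    by (auto simp: inc_def)
  have "f x < m" if "x \<in> S" for x
  proof -
    have x: "x \<in> {1..m - 1}" using that S(1) by blast
    then have "f x \<le> m" using permutes_in_image[OF assms(1), of x] by auto
    moreover have "f x \<noteq> m" using x permutes_inj[OF assms(1)] assms(2,3) by (auto dest: injD[where x = x and y = m])
    ultimately show ?thesis by simp
  qed
  moreover have "x < m" if "x \<in> S" for x using that S(1) assms(3) by fastforce
  ultimately have "strict_mono_on (insert m S) f"
    using S(4) assms(2) by (fastforce simp: strict_mono_on_def)
  moreover have "m \<notin> S" using \<open>\<And>x. x \<in> S \<Longrightarrow> x < m\<close> by blast
  moreover have "insert m S \<subseteq> {1..m}" using S(1) assms(3) by fastforce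
  ultimately show "inc (Suc k) f {1..m}" using S unfolding inc_def
    by (intro exI[of _ "insert m S"]) auto
qed

text \<open>As a permutation, 132 is its own inverse, so exchanging positions and values preserves
  it. The values in increasing order are \<open>f a\<close>, \<open>f c\<close>, \<open>f b\<close>,
  hence the order in the witness.\<close>

lemma card_occ_inv:
  assumes "f permutes A"
  shows "card (occ (inv f) A) = card (occ f A)"
proof -
  note simps = permutes_in_image[OF assms] permutes_in_image[OF permutes_inv[OF assms]]
    permutes_inverses[OF assms]
  have "bij_betw (\<lambda>(a, b, c). (f a, f c, f b)) (occ f A) (occ (inv f) A)"
    by (rule bij_betw_byWitness[where f' = "\<lambda>(a, b, c). (inv f a, inv f c, inv f b)"])
      (auto simp: occ_def simps)
  then show ?thesis by (metis bij_betw_same_card)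
qed

lemma inc_inv_imp:
  assumes "f permutes A" "inc k f A"
  shows "inc k (inv f) A"
proof -
  obtain S where S: "S \<subseteq> A" "finite S" "card S = k" "strict_mono_on S f"
    using assms(2) by (auto simp: inc_def)
  have "strict_mono_on (f ` S) (inv f)"
    using S(4) by (auto simp: strict_mono_on_def permutes_inverses[OF assms(1)])
      (metis linorder_less_linear order.asym)
  moreover have "f ` S \<subseteq> A"
    using S(1) permutes_image[OF assms(1)] by blast
  moreover have "card (f ` S) = k"
    using S permutes_inj_on[OF assms(1)] by (simp add: card_image)
  ultimately show ?thesis using S(2) unfolding inc_def by blast
qed

lemma inc_inv:
  assumes "f permutes A"
  shows "inc k (inv f) A \<longleftrightarrow> inc k f A"
  using inc_inv_imp[OF assms] inc_inv_imp[OF permutes_inv[OF assms]] permutes_inv_inv[OF assms]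
  by metis

subsection \<open>Skew sums\<close>

text \<open>The skew sum: the block of \<sigma> stands to the left of and above the block of \<rho>.
  Points outside \<open>{1..m + n}\<close> are fixed, as \<open>permutes\<close> demands.\<close>

definition skew :: "nat \<Rightarrow> nat \<Rightarrow> (nat \<Rightarrow> nat) \<Rightarrow> (nat \<Rightarrow> nat) \<Rightarrow> nat \<Rightarrow> nat" where
  "skew m n \<sigma> \<rho> x =
     (if x \<in> {1..m} then \<sigma> x + n else if x \<in> {m + 1..m + n} then \<rho> (x - m) else x)"

lemma permutes_range:
  assumes "f permutes {1..m}" "1 \<le> x" "x \<le> (m::nat)"
  shows "1 \<le> f x" "f x \<le> m"
  using permutes_in_image[OF assms(1), of x] assms(2,3) by auto

text \<open>Reflection in the diagonal exchanges the two antidiagonal blocks. Used in both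
  directions, this one-sided identity yields both bijectivity and the inverse.\<close>

lemma skew_comp_inverse:
  assumes "\<sigma> permutes {1..m}" "\<rho> permutes {1..n}"
  shows "skew n m (inv \<rho>) (inv \<sigma>) \<circ> skew m n \<sigma> \<rho> = id"
proof
  fix x
  consider "x \<in> {1..m}" | "x \<in> {m + 1..m + n}" | "x \<notin> {1..m + n}" by force
  then show "(skew n m (inv \<rho>) (inv \<sigma>) \<circ> skew m n \<sigma> \<rho>) x = id x"
  proof cases
    case 1
    with permutes_range[OF assms(1), of x] show ?thesis
      by (auto simp: skew_def permutes_inverses[OF assms(1)])
  next
    case 2
    then have "1 \<le> \<rho> (x - m)" "\<rho> (x - m) \<le> n" using permutes_range[OF assms(2), of "x - m"] by auto
    with 2 show ?thesis
      by (auto simp: skew_def permutes_inverses[OF assms(2)])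
  next
    case 3
    then show ?thesis by (auto simp: skew_def)
  qed
qed

lemma skew_inv:
  assumes "\<sigma> permutes {1..m}" "\<rho> permutes {1..n}"
  shows "inv (skew m n \<sigma> \<rho>) = skew n m (inv \<rho>) (inv \<sigma>)"
  using skew_comp_inverse[OF assms]
    skew_comp_inverse[OF permutes_inv[OF assms(2)] permutes_inv[OF assms(1)]]
  by (intro inv_unique_comp) (simp_all add: permutes_inv_inv[OF assms(1)] permutes_inv_inv[OF assms(2)])

lemma skew_permutes:
  assumes "\<sigma> permutes {1..m}" "\<rho> permutes {1..n}"
  shows "skew m n \<sigma> \<rho> permutes {1..m + n}"
proof -
  have "bij (skew m n \<sigma> \<rho>)"
    using skew_comp_inverse[OF assms]
      skew_comp_inverse[OF permutes_inv[OF assms(2)] permutes_inv[OF assms(1)]]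
    by (intro o_bij[of "skew n m (inv \<rho>) (inv \<sigma>)"])
      (simp_all add: permutes_inv_inv[OF assms(1)] permutes_inv_inv[OF assms(2)])
  then show ?thesis by (auto simp: permutes_def bij_iff skew_def)
qed

lemma skew_inject:
  assumes "\<sigma> permutes {1..m}" "\<rho> permutes {1..n}" "\<sigma>' permutes {1..m}" "\<rho>' permutes {1..n}"
    and eq: "skew m n \<sigma> \<rho> = skew m n \<sigma>' \<rho>'"
  shows "\<sigma> = \<sigma>'" "\<rho> = \<rho>'"
proof -
  have "\<sigma> x = \<sigma>' x" for x
  proof (cases "x \<in> {1..m}")
    case True
    with fun_cong[OF eq, of x] show ?thesis by (auto simp: skew_def)
  next
    case False
    then show ?thesis using assms by (simp add: permutes_not_in)
  qed
  then show "\<sigma> = \<sigma>'" by auto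
  have "\<rho> x = \<rho>' x" for x
  proof (cases "x \<in> {1..n}")
    case True
    with fun_cong[OF eq, of "x + m"] show ?thesis by (auto simp: skew_def)
  next
    case False
    then show ?thesis using assms by (simp add: permutes_not_in)
  qed
  then show "\<rho> = \<rho>'" by auto
qed

text \<open>The inverse of a three-block sum comes out bracketed to the left; this restores the
  bracketing of \<open>blk\<close>.\<close>

lemma skew_assoc:
  assumes "\<sigma> permutes {1..l}" "\<tau> permutes {1..m}" "\<rho> permutes {1..n}"
  shows "skew (l + m) n (skew l m \<sigma> \<tau>) \<rho> = skew l (m + n) \<sigma> (skew m n \<tau> \<rho>)"
  by (rule ext) (auto simp: skew_def)

lemma skew_split:
  assumes \<alpha>: "\<alpha> permutes {1..m + n}" and img: "\<alpha> ` {1..m} = {n + 1..n + m}"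
  obtains \<sigma> \<rho> where "\<sigma> permutes {1..m}" "\<rho> permutes {1..n}" "\<alpha> = skew m n \<sigma> \<rho>"
proof -
  have inj: "inj_on \<alpha> A" for A using permutes_inj_on[OF \<alpha>] .
  have "\<alpha> ` ({1..m + n} - {1..m}) = {1..m + n} - {n + 1..n + m}"
    using img permutes_image[OF \<alpha>] by (simp add: image_set_diff[OF permutes_inj[OF \<alpha>]])
  moreover have "{1..m + n} - {1..m} = {m + 1..m + n}" "{1..m + n} - {n + 1..n + m} = {1..n}"
    by auto
  ultimately have img2: "\<alpha> ` {m + 1..m + n} = {1..n}" by simp
  define \<sigma> where "\<sigma> = (\<lambda>x. if x \<in> {1..m} then \<alpha> x - n else x)"
  define \<rho> where "\<rho> = (\<lambda>x. if x \<in> {1..n} then \<alpha> (x + m) else x)"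
  have "bij_betw \<sigma> {1..m} {1..m}"
  proof -
    have "bij_betw (\<lambda>y. y - n) {n + 1..n + m} {1..m}"
      by (rule bij_betw_byWitness[where f' = "\<lambda>y. y + n"]) auto
    moreover have "bij_betw \<alpha> {1..m} {n + 1..n + m}" using inj img by (simp add: bij_betw_def)
    ultimately have "bij_betw ((\<lambda>y. y - n) \<circ> \<alpha>) {1..m} {1..m}" by (rule bij_betw_trans[rotated])
    then show ?thesis by (rule bij_betw_cong[THEN iffD1, rotated]) (auto simp: \<sigma>_def)
  qed
  then have p1: "\<sigma> permutes {1..m}" by (rule bij_imp_permutes) (auto simp: \<sigma>_def)
  have "bij_betw \<rho> {1..n} {1..n}"
  proof -
    have "bij_betw (\<lambda>y. y + m) {1..n} {m + 1..m + n}"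
      by (rule bij_betw_byWitness[where f' = "\<lambda>y. y - m"]) auto
    moreover have "bij_betw \<alpha> {m + 1..m + n} {1..n}" using inj img2 by (simp add: bij_betw_def)
    ultimately have "bij_betw (\<alpha> \<circ> (\<lambda>y. y + m)) {1..n} {1..n}" by (rule bij_betw_trans)
    then show ?thesis by (rule bij_betw_cong[THEN iffD1, rotated]) (auto simp: \<rho>_def)
  qed
  then have p2: "\<rho> permutes {1..n}" by (rule bij_imp_permutes) (auto simp: \<rho>_def)
  have "\<alpha> x = skew m n \<sigma> \<rho> x" for x
  proof -
    consider "x \<in> {1..m}" | "x \<in> {m + 1..m + n}" | "x \<notin> {1..m + n}" by force
    then show ?thesis
    proof cases
      case 1
      then have "\<alpha> x \<in> {n + 1..n + m}" using img by blast
      with 1 show ?thesis by (auto simp: skew_def \<sigma>_def)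
    next
      case 2
      then show ?thesis by (auto simp: skew_def \<rho>_def)
    next
      case 3
      then show ?thesis using permutes_not_in[OF \<alpha>, of x] by (auto simp: skew_def)
    qed
  qed
  then have "\<alpha> = skew m n \<sigma> \<rho>" ..
  with p1 p2 show ?thesis by (rule that)
qed

section \<open>Triples and increasing sets in a skew sum\<close>

lemma atLeastAtMost_shift: "{m + 1..m + n} = (\<lambda>x. x + m) ` {1..n::nat}"
  by (auto simp: image_iff intro!: bexI[of _ "_ - m"])

lemma skew_antitone:
  assumes "\<sigma> permutes {1..m}" "\<rho> permutes {1..n}" "x \<in> {1..m}" "y \<in> {m + 1..m + n}"
  shows "x < y \<and> skew m n \<sigma> \<rho> y < skew m n \<sigma> \<rho> x"
proof -
  have "1 \<le> \<sigma> x" using permutes_range(1)[OF assms(1), of x] assms(3) by simp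
  moreover have "\<rho> (y - m) \<le> n" using permutes_range(2)[OF assms(2), of "y - m"] assms(4) by auto
  ultimately show ?thesis using assms(3,4) by (auto simp: skew_def)
qed

lemma card_occ_skew:
  assumes "\<sigma> permutes {1..m}" "\<rho> permutes {1..n}"
  shows "card (occ (skew m n \<sigma> \<rho>) {1..m + n}) = card (occ \<sigma> {1..m}) + card (occ \<rho> {1..n})"
proof -
  have "{1..m + n} = {1..m} \<union> {m + 1..m + n}" by auto
  moreover have "occ (skew m n \<sigma> \<rho>) {1..m} = occ \<sigma> {1..m}"
    by (rule occ_cong) (auto simp: skew_def)
  moreover have "card (occ (skew m n \<sigma> \<rho>) {m + 1..m + n}) = card (occ \<rho> {1..n})"
    unfolding atLeastAtMost_shift
    by (subst card_occ_image) (auto simp: strict_mono_on_def skew_def intro!: arg_cong[of _ _ card] occ_cong)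
  ultimately show ?thesis
    using card_occ_antitone_union[of "{1..m}" "{m + 1..m + n}", OF skew_antitone[OF assms]] by simp
qed

lemma inc_skew:
  assumes "\<sigma> permutes {1..m}" "\<rho> permutes {1..n}"
  shows "inc k (skew m n \<sigma> \<rho>) {1..m + n} \<longleftrightarrow> inc k \<sigma> {1..m} \<or> inc k \<rho> {1..n}"
proof -
  have "{1..m + n} = {1..m} \<union> {m + 1..m + n}" by auto
  moreover have "inc k (skew m n \<sigma> \<rho>) {1..m} = inc k \<sigma> {1..m}"
    by (rule inc_cong) (auto simp: skew_def)
  moreover have "inc k (skew m n \<sigma> \<rho>) {m + 1..m + n} = inc k \<rho> {1..n}"
    unfolding atLeastAtMost_shift
    by (subst inc_image) (auto simp: strict_mono_on_def skew_def intro!: inc_cong)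
  ultimately show ?thesis
    using inc_antitone_union[of "{1..m}" "{m + 1..m + n}", OF skew_antitone[OF assms]] by simp
qed

text \<open>Each value on the first \<open>m\<close> positions exceeds the \<open>n - m\<close>
  values to the right, so it is at least \<open>n - m + 1\<close>; equal cardinalities then give
  equality.\<close>

lemma image_top_block:
  fixes \<alpha> :: "nat \<Rightarrow> nat"
  assumes \<alpha>: "\<alpha> permutes {1..n}" and "m \<le> n"
    and sep: "\<And>l r. l \<in> {1..m} \<Longrightarrow> r \<in> {m + 1..n} \<Longrightarrow> \<alpha> r < \<alpha> l"
  shows "\<alpha> ` {1..m} = {n - m + 1..n}"
proof (rule card_subset_eq)
  have inj: "inj_on \<alpha> A" for A using permutes_inj_on[OF \<alpha>] .
  show "\<alpha> ` {1..m} \<subseteq> {n - m + 1..n}"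
  proof
    fix y assume "y \<in> \<alpha> ` {1..m}"
    then obtain l where l: "l \<in> {1..m}" "y = \<alpha> l" by auto
    have "\<alpha> ` {m + 1..n} \<subseteq> {1..<y}"
      using sep[OF l(1)] permutes_range[OF \<alpha>] l by force
    then have "card (\<alpha> ` {m + 1..n}) \<le> card {1..<y}" by (intro card_mono) auto
    then have "n - m \<le> y - 1" by (simp add: card_image[OF inj])
    moreover have "1 \<le> y" "y \<le> n" using permutes_range[OF \<alpha>, of l] l \<open>m \<le> n\<close> by auto
    ultimately show "y \<in> {n - m + 1..n}" by auto
  qed
  show "card (\<alpha> ` {1..m}) = card {n - m + 1..n}" using \<open>m \<le> n\<close> by (simp add: card_image[OF inj])
qed simp

subsection \<open>Permutations avoiding 132\<close>

lemma avoids_id_iff: "avoids k id n \<alpha> \<longleftrightarrow> \<not> inc k \<alpha> {1..n}"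
proof -
  have "inc k \<alpha> {1..n}" if "i \<in> occurrences k id n \<alpha>" for i
  proof -
    have i: "i ` {1..k} \<subseteq> {1..n}" "strict_mono_on {1..k} i"
      and mono: "\<And>a b. a \<in> {1..k} \<Longrightarrow> b \<in> {1..k} \<Longrightarrow> a < b \<Longrightarrow> \<alpha> (i a) < \<alpha> (i b)"
      using that by (auto simp: occurrences_def)
    have "card (i ` {1..k}) = k"
      using strict_mono_on_imp_inj_on[OF i(2)] by (simp add: card_image)
    moreover have "strict_mono_on (i ` {1..k}) \<alpha>"
      using mono strict_mono_on_less[OF i(2)] unfolding strict_mono_on_def by blast
    ultimately show ?thesis using i(1) unfolding inc_def by blast
  qed
  moreover have "occurrences k id n \<alpha> \<noteq> {}" if inc: "inc k \<alpha> {1..n}"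
  proof -
    obtain S where S: "S \<subseteq> {1..n}" "finite S" "card S = k" "strict_mono_on S \<alpha>"
      using inc by (auto simp: inc_def)
    obtain h where h: "bij_betw h {..<k} S" "strict_mono_on {..<k} h"
      using ex_bij_betw_strict_mono_card[OF S(2)] S(3) by metis
    \<comment> \<open>\<open>h\<close> enumerates \<open>S\<close> increasingly from index 0, while
      pattern positions start at 1.\<close>
    define i where "i = (\<lambda>a\<in>{1..k}. h (a - 1))"
    have i_in: "i a \<in> S" if "a \<in> {1..k}" for a
      using bij_betwE[OF h(1)] that by (auto simp: i_def)
    have i_less: "i a < i b \<longleftrightarrow> a < b" if "a \<in> {1..k}" "b \<in> {1..k}" for a b
    proof -
      have "i a < i b \<longleftrightarrow> a - 1 < b - 1"
        using that strict_mono_on_less[OF h(2), of "a - 1" "b - 1"] by (auto simp: i_def)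
      also have "\<dots> \<longleftrightarrow> a < b" using that by auto
      finally show ?thesis .
    qed
    have "\<alpha> (i a) < \<alpha> (i b) \<longleftrightarrow> a < b" if "a \<in> {1..k}" "b \<in> {1..k}" for a b
      using that i_less strict_mono_on_less[OF S(4) i_in i_in] by blast
    moreover have "strict_mono_on {1..k} i" using i_less by (auto simp: strict_mono_on_def)
    moreover have "i \<in> {1..k} \<rightarrow>\<^sub>E {1..n}" using i_in S(1) by (auto simp: i_def)
    ultimately have "i \<in> occurrences k id n \<alpha>" by (auto simp: occurrences_def)
    then show ?thesis by blast
  qed
  ultimately show ?thesis unfolding avoids_def by blast
qed

lemma card_occurrences_132: "card (occurrences 3 pattern_132 n \<alpha>) = card (occ \<alpha> {1..n})"
proof -
  have set3: "{1..3} = {1, 2, 3::nat}" by auto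
  have pat: "pattern_132 1 = 1" "pattern_132 2 = 3" "pattern_132 3 = 2"
    by (auto simp: pattern_132_def transpose_def)
  \<comment> \<open>\<open>g\<close> rebuilds the extensional index sequence from its three values
    and so inverts evaluation at 1, 2, 3.\<close>
  define g where "g = (\<lambda>(a, b, c). (\<lambda>x\<in>{1..3::nat}. if x = 1 then a else if x = 2 then b else c :: nat))"
  have "bij_betw (\<lambda>i. (i 1, i 2, i 3)) (occurrences 3 pattern_132 n \<alpha>) (occ \<alpha> {1..n})"
  proof (rule bij_betw_byWitness[where f' = g])
    show "\<forall>i\<in>occurrences 3 pattern_132 n \<alpha>. g (i 1, i 2, i 3) = i"
    proof
      fix i assume "i \<in> occurrences 3 pattern_132 n \<alpha>"
      then have "i \<in> extensional {1..3}" by (auto simp: occurrences_def PiE_def)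
      then show "g (i 1, i 2, i 3) = i"
        unfolding set3 by (intro extensionalityI[of _ "{1, 2, 3}"]) (auto simp: g_def set3)
    qed
    show "\<forall>t\<in>occ \<alpha> {1..n}. (g t 1, g t 2, g t 3) = t" by (auto simp: g_def)
    show "(\<lambda>i. (i 1, i 2, i 3)) ` occurrences 3 pattern_132 n \<alpha> \<subseteq> occ \<alpha> {1..n}"
    proof clarify
      fix i assume "i \<in> occurrences 3 pattern_132 n \<alpha>"
      then have i: "i \<in> {1, 2, 3} \<rightarrow> {1..n}" "strict_mono_on {1, 2, 3} i"
        "\<forall>a\<in>{1, 2, 3}. \<forall>b\<in>{1, 2, 3}. \<alpha> (i a) < \<alpha> (i b) \<longleftrightarrow> pattern_132 a < pattern_132 b"
        unfolding occurrences_def set3 by (auto simp: PiE_def)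
      have "i 1 < i 2" "i 2 < i 3" using i(2) by (auto simp: strict_mono_on_def)
      moreover have "\<alpha> (i 1) < \<alpha> (i 3)" "\<alpha> (i 3) < \<alpha> (i 2)"
        using i(3) pat by auto
      moreover have "i 1 \<in> {1..n}" "i 2 \<in> {1..n}" "i 3 \<in> {1..n}" using i(1) by blast+
      ultimately show "(i 1, i 2, i 3) \<in> occ \<alpha> {1..n}" unfolding occ_def by blast
    qed
    show "g ` occ \<alpha> {1..n} \<subseteq> occurrences 3 pattern_132 n \<alpha>"
    proof clarify
      fix a b c assume abc: "(a, b, c) \<in> occ \<alpha> {1..n}"
      have g: "g (a, b, c) 1 = a" "g (a, b, c) 2 = b" "g (a, b, c) 3 = c" by (auto simp: g_def)
      have "g (a, b, c) \<in> {1..3} \<rightarrow>\<^sub>E {1..n}"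
        using abc by (auto simp: g_def occ_def)
      moreover have "strict_mono_on {1..3} (g (a, b, c))"
        unfolding set3 strict_mono_on_def using abc g by (auto simp: occ_def)
      moreover have "\<forall>x\<in>{1..3}. \<forall>y\<in>{1..3}. \<alpha> (g (a, b, c) x) < \<alpha> (g (a, b, c) y)
          \<longleftrightarrow> pattern_132 x < pattern_132 y"
        unfolding set3 using abc g pat by (auto simp: occ_def)
      ultimately show "g (a, b, c) \<in> occurrences 3 pattern_132 n \<alpha>"
        unfolding occurrences_def by blast
    qed
  qed
  then show ?thesis by (rule bij_betw_same_card)
qed

text \<open>The set \<open>occ \<sigma> {1..n}\<close> is finite, so cardinality 0 means avoidance
  of 132; in this form the additive formula for skew sums applies directly.\<close>

definition C_set :: "nat \<Rightarrow> nat \<Rightarrow> (nat \<Rightarrow> nat) set" where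
  "C_set k n = {\<sigma>. \<sigma> permutes {1..n} \<and> \<not> inc k \<sigma> {1..n} \<and> card (occ \<sigma> {1..n}) = 0}"

text \<open>The condition \<open>1 \<le> n\<close> excludes the empty permutation, for which
  \<open>\<sigma> 0 = 0\<close> would hold.\<close>

definition D_set :: "nat \<Rightarrow> nat \<Rightarrow> (nat \<Rightarrow> nat) set" where
  "D_set k n = {\<sigma> \<in> C_set k n. 1 \<le> n \<and> \<sigma> n = n}"

definition J_set :: "nat \<Rightarrow> nat \<Rightarrow> (nat \<Rightarrow> nat) set" where
  "J_set k n = {\<alpha>. \<alpha> permutes {1..n} \<and> inv \<alpha> = \<alpha> \<and> \<not> inc k \<alpha> {1..n} \<and> card (occ \<alpha> {1..n}) = 1}"

lemma J_count_eq: "J_count k n = card (J_set k n)"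
  unfolding J_count_def J_set_def avoids_id_iff contains_exactly_once_def card_occurrences_132 ..

lemma finite_C_set: "finite (C_set k n)"
  by (rule finite_subset[OF _ finite_permutations[of "{1..n}"]]) (auto simp: C_set_def)

lemma finite_J_set: "finite (J_set k n)"
  by (rule finite_subset[OF _ finite_permutations[of "{1..n}"]]) (auto simp: J_set_def)

lemma permutes_fixed_max:
  fixes n :: nat
  assumes "1 \<le> n"
  shows "f permutes {1..n - 1} \<longleftrightarrow> f permutes {1..n} \<and> f n = n"
proof -
  have "{1..n} = insert n {1..n - 1}" using assms by auto
  then show ?thesis
    using assms permutes_subset[of f "{1..n - 1}" "{1..n}"] permutes_not_in[of f "{1..n - 1}" n]
      permutes_superset[of f "{1..n}" "{1..n - 1}"] by fastforce
qed

text \<open>Deleting a final maximum does not change the function, since a permutation of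
  \<open>{1..n}\<close> already fixes \<open>Suc n\<close>; only the bound on increasing sets drops
  by one.\<close>

lemma D_set_Suc: "D_set (Suc k) (Suc n) = C_set k n"
proof -
  have "f \<in> D_set (Suc k) (Suc n) \<longleftrightarrow> f \<in> C_set k n" for f
  proof (cases "f permutes {1..Suc n} \<and> f (Suc n) = Suc n")
    case True
    then show ?thesis
      using permutes_fixed_max[of "Suc n" f] occ_fixed_max[of f "Suc n"] inc_fixed_max[of f "Suc n" k]
      by (simp add: D_set_def C_set_def)
  next
    case False
    then show ?thesis
      using permutes_fixed_max[of "Suc n" f] by (auto simp: D_set_def C_set_def)
  qed
  then show ?thesis by blast
qed

lemma D_set_0: "D_set k 0 = {}"
  by (simp add: D_set_def)

section \<open>Initial values and recurrence for permutations avoiding 132\<close>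

lemma inc_0: "inc 0 f A"
  by (auto simp: inc_def intro!: exI[of _ "{}"])

lemma C_set_0: "C_set 0 n = {}"
  by (simp add: C_set_def inc_0)

lemma card_C_set_Suc_0: "card (C_set (Suc k) 0) = 1"
proof -
  have "occ id {} = {}" by (auto simp: occ_def)
  then have "C_set (Suc k) 0 = {id}" by (auto simp: C_set_def inc_def)
  then show ?thesis by simp
qed

lemma skew_last: "1 \<le> n \<Longrightarrow> skew m n \<sigma> \<rho> (m + n) = \<rho> n"
  by (simp add: skew_def)

text \<open>Here \<open>m\<close> is the position of the maximum, and the permutation is cut right
  after it.\<close>

lemma bij_betw_C_split:
  assumes "1 \<le> m"
  shows "bij_betw (\<lambda>(\<sigma>, \<rho>). skew m n \<sigma> \<rho>) (D_set k m \<times> C_set k n) {\<alpha> \<in> C_set k (m + n). \<alpha> m = m + n}"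
  unfolding bij_betw_def
proof
  show "inj_on (\<lambda>(\<sigma>, \<rho>). skew m n \<sigma> \<rho>) (D_set k m \<times> C_set k n)"
  proof (rule inj_onI, clarify)
    fix \<sigma> \<rho> \<sigma>' \<rho>'
    assume *: "\<sigma> \<in> D_set k m" "\<rho> \<in> C_set k n" "\<sigma>' \<in> D_set k m" "\<rho>' \<in> C_set k n"
      and eq: "skew m n \<sigma> \<rho> = skew m n \<sigma>' \<rho>'"
    show "\<sigma> = \<sigma>' \<and> \<rho> = \<rho>'"
      using skew_inject[OF _ _ _ _ eq] * by (simp add: D_set_def C_set_def)
  qed
  show "(\<lambda>(\<sigma>, \<rho>). skew m n \<sigma> \<rho>) ` (D_set k m \<times> C_set k n) = {\<alpha> \<in> C_set k (m + n). \<alpha> m = m + n}"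
  proof
    show "(\<lambda>(\<sigma>, \<rho>). skew m n \<sigma> \<rho>) ` (D_set k m \<times> C_set k n) \<subseteq> {\<alpha> \<in> C_set k (m + n). \<alpha> m = m + n}"
    proof clarify
      fix \<sigma> \<rho> assume \<sigma>: "\<sigma> \<in> D_set k m" and \<rho>: "\<rho> \<in> C_set k n"
      then have p: "\<sigma> permutes {1..m}" "\<rho> permutes {1..n}" by (auto simp: D_set_def C_set_def)
      have "skew m n \<sigma> \<rho> m = m + n" using \<sigma> by (simp add: D_set_def skew_def)
      then show "skew m n \<sigma> \<rho> \<in> C_set k (m + n) \<and> skew m n \<sigma> \<rho> m = m + n"
        using \<sigma> \<rho> skew_permutes[OF p] inc_skew[OF p] card_occ_skew[OF p]
        unfolding D_set_def C_set_def by simp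
    qed
    show "{\<alpha> \<in> C_set k (m + n). \<alpha> m = m + n} \<subseteq> (\<lambda>(\<sigma>, \<rho>). skew m n \<sigma> \<rho>) ` (D_set k m \<times> C_set k n)"
    proof clarify
      fix \<alpha> assume \<alpha>: "\<alpha> \<in> C_set k (m + n)" and m: "\<alpha> m = m + n"
      have perm: "\<alpha> permutes {1..m + n}" using \<alpha> by (simp add: C_set_def)
      have empty: "occ \<alpha> {1..m + n} = {}" using \<alpha> by (simp add: C_set_def finite_occ)
      \<comment> \<open>Otherwise \<open>l\<close>, the position \<open>m\<close> of the maximum,
        and \<open>r\<close> would form a 132.\<close>
      have "\<alpha> r < \<alpha> l" if l: "l \<in> {1..m}" and r: "r \<in> {m + 1..m + n}" for l r
      proof (rule ccontr)
        assume "\<not> \<alpha> r < \<alpha> l"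
        moreover have "\<alpha> r \<noteq> \<alpha> l" "\<alpha> r \<noteq> \<alpha> m"
          using l r inj_eq[OF permutes_inj[OF perm]] by auto
        moreover have "\<alpha> r \<le> m + n" using permutes_range(2)[OF perm, of r] r by simp
        ultimately have "\<alpha> l < \<alpha> r" "\<alpha> r < \<alpha> m" "l \<noteq> m" using m by auto
        then have "(l, m, r) \<in> occ \<alpha> {1..m + n}" using l r by (auto simp: occ_def)
        with empty show False by simp
      qed
      then have "\<alpha> ` {1..m} = {n + 1..n + m}"
        using image_top_block[OF perm, of m] by (simp add: add.commute)
      then obtain \<sigma> \<rho> where *: "\<sigma> permutes {1..m}" "\<rho> permutes {1..n}" "\<alpha> = skew m n \<sigma> \<rho>"
        using skew_split[OF perm] by metis
      have "\<sigma> m = m" using m * assms by (simp add: skew_def)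
      then have "\<sigma> \<in> D_set k m" "\<rho> \<in> C_set k n"
        using * \<alpha> assms inc_skew[OF *(1,2)] card_occ_skew[OF *(1,2)]
        by (simp_all add: D_set_def C_set_def)
      with * show "\<alpha> \<in> (\<lambda>(\<sigma>, \<rho>). skew m n \<sigma> \<rho>) ` (D_set k m \<times> C_set k n)" by force
    qed
  qed
qed

lemma card_C_set_rec:
  assumes "1 \<le> n"
  shows "card (C_set k n) = (\<Sum>m = 1..n. card (D_set k m) * card (C_set k (n - m)))"
proof -
  have "C_set k n = (\<Union>m\<in>{1..n}. {\<alpha> \<in> C_set k n. \<alpha> m = n})"
  proof -
    have "\<exists>m\<in>{1..n}. \<alpha> m = n" if "\<alpha> \<in> C_set k n" for \<alpha>
    proof -
      have "\<alpha> permutes {1..n}" using that by (simp add: C_set_def)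
      from permutes_image[OF this] show ?thesis using assms by (metis atLeastAtMost_iff image_iff order_refl)
    qed
    then show ?thesis by auto
  qed
  moreover have "card (\<Union>m\<in>{1..n}. {\<alpha> \<in> C_set k n. \<alpha> m = n})
      = (\<Sum>m = 1..n. card {\<alpha> \<in> C_set k n. \<alpha> m = n})"
  proof (rule card_UN_disjoint)
    show "\<forall>i\<in>{1..n}. \<forall>j\<in>{1..n}. i \<noteq> j \<longrightarrow>
        {\<alpha> \<in> C_set k n. \<alpha> i = n} \<inter> {\<alpha> \<in> C_set k n. \<alpha> j = n} = {}"
      by (auto simp: C_set_def dest!: permutes_inj dest: injD)
  qed (auto simp: finite_C_set)
  moreover have "card {\<alpha> \<in> C_set k n. \<alpha> m = n} = card (D_set k m) * card (C_set k (n - m))"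
    if "m \<in> {1..n}" for m
    using bij_betw_same_card[OF bij_betw_C_split[of m "n - m" k]] that
    by (simp add: card_cartesian_product)
  ultimately show ?thesis by simp
qed

subsection \<open>Involutions with exactly one 132\<close>

text \<open>Since inversion reverses and inverts the three blocks, the outer pair \<sigma>,
  \<open>inv \<sigma>\<close> is preserved, and the whole is an involution as soon as \<tau>
  is.\<close>

definition blk :: "nat \<Rightarrow> nat \<Rightarrow> (nat \<Rightarrow> nat) \<Rightarrow> (nat \<Rightarrow> nat) \<Rightarrow> nat \<Rightarrow> nat" where
  "blk m q \<sigma> \<tau> = skew m (q + m) \<sigma> (skew q m \<tau> (inv \<sigma>))"

context
  fixes m q :: nat and \<sigma> \<tau> :: "nat \<Rightarrow> nat"
  assumes \<sigma>: "\<sigma> permutes {1..m}" and \<tau>: "\<tau> permutes {1..q}"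
begin

lemma blk_permutes: "blk m q \<sigma> \<tau> permutes {1..m + (q + m)}"
  unfolding blk_def by (intro skew_permutes permutes_inv \<sigma> \<tau>)

lemma blk_inv: "inv (blk m q \<sigma> \<tau>) = blk m q \<sigma> (inv \<tau>)"
proof -
  have "inv (blk m q \<sigma> \<tau>) = skew (q + m) m (skew m q \<sigma> (inv \<tau>)) (inv \<sigma>)"
    unfolding blk_def
    by (simp only: skew_inv[OF \<sigma> skew_permutes[OF \<tau> permutes_inv[OF \<sigma>]]]
        skew_inv[OF \<tau> permutes_inv[OF \<sigma>]] permutes_inv_inv[OF \<sigma>])
  also have "\<dots> = blk m q \<sigma> (inv \<tau>)"
    unfolding blk_def using skew_assoc[OF \<sigma> permutes_inv[OF \<tau>] permutes_inv[OF \<sigma>]]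
    by (simp add: add.commute)
  finally show ?thesis .
qed

text \<open>Both outer blocks contribute equally. A total of 1 therefore forces \<sigma> to avoid
  132 and \<tau> to carry the only occurrence.\<close>

lemma card_occ_blk:
  "card (occ (blk m q \<sigma> \<tau>) {1..m + (q + m)}) = 2 * card (occ \<sigma> {1..m}) + card (occ \<tau> {1..q})"
  unfolding blk_def
  by (simp only: card_occ_skew[OF \<sigma> skew_permutes[OF \<tau> permutes_inv[OF \<sigma>]]]
      card_occ_skew[OF \<tau> permutes_inv[OF \<sigma>]] card_occ_inv[OF \<sigma>])

lemma inc_blk:
  "inc k (blk m q \<sigma> \<tau>) {1..m + (q + m)} \<longleftrightarrow> inc k \<sigma> {1..m} \<or> inc k \<tau> {1..q}"
  unfolding blk_def
  by (auto simp only: inc_skew[OF \<sigma> skew_permutes[OF \<tau> permutes_inv[OF \<sigma>]]]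
      inc_skew[OF \<tau> permutes_inv[OF \<sigma>]] inc_inv[OF \<sigma>])

end

lemma blk_inject:
  assumes "\<sigma> permutes {1..m}" "\<tau> permutes {1..q}" "\<sigma>' permutes {1..m}" "\<tau>' permutes {1..q}"
    and "blk m q \<sigma> \<tau> = blk m q \<sigma>' \<tau>'"
  shows "\<sigma> = \<sigma>'" "\<tau> = \<tau>'"
proof -
  note perms = assms(1-4) assms(1,3)[THEN permutes_inv]
  note eq = assms(5)[unfolded blk_def]
  show "\<sigma> = \<sigma>'" by (rule skew_inject(1)[OF _ _ _ _ eq]) (intro perms skew_permutes)+
  have "skew q m \<tau> (inv \<sigma>) = skew q m \<tau>' (inv \<sigma>')"
    by (rule skew_inject(2)[OF _ _ _ _ eq]) (intro perms skew_permutes)+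
  then show "\<tau> = \<tau>'" by (rule skew_inject(1)[rotated 4]) (intro perms)+
qed

text \<open>Cutting twice gives blocks \<sigma>, \<tau>, \<open>\<sigma>'\<close>. Comparing
  \<alpha> with its inverse, whose blocks are \<open>inv \<sigma>'\<close>,
  \<open>inv \<tau>\<close>, \<open>inv \<sigma>\<close>, identifies them.\<close>

lemma blk_split:
  assumes \<alpha>: "\<alpha> permutes {1..m + (q + m)}" and invol: "inv \<alpha> = \<alpha>"
    and img: "\<alpha> ` {1..m} = {q + m + 1..q + m + m}"
  obtains \<sigma> \<tau> where "\<sigma> permutes {1..m}" "\<tau> permutes {1..q}" "inv \<tau> = \<tau>" "\<alpha> = blk m q \<sigma> \<tau>"
proof -
  obtain \<sigma> \<beta> where \<sigma>: "\<sigma> permutes {1..m}" and \<beta>: "\<beta> permutes {1..q + m}"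
    and \<alpha>_eq: "\<alpha> = skew m (q + m) \<sigma> \<beta>"
    using skew_split[OF \<alpha> img] .
  have \<alpha>\<alpha>: "\<alpha> (\<alpha> x) = x" for x using permutes_inverses(1)[OF \<alpha>] invol by simp
  have "\<alpha> ` {q + m + 1..q + m + m} = \<alpha> ` \<alpha> ` {1..m}" using img by simp
  also have "\<dots> = {1..m}" by (simp add: image_image \<alpha>\<alpha>)
  finally have "\<alpha> ` {q + m + 1..q + m + m} = {1..m}" .
  moreover have "\<beta> ` {q + 1..q + m} = \<alpha> ` {q + m + 1..q + m + m}"
  proof -
    have "\<beta> ` {q + 1..q + m} = (\<lambda>x. \<alpha> (x + m)) ` {q + 1..q + m}"
      by (rule image_cong) (auto simp: \<alpha>_eq skew_def)
    also have "\<dots> = \<alpha> ` (\<lambda>x. x + m) ` {q + 1..q + m}" by (simp only: image_image)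
    also have "(\<lambda>x. x + m) ` {q + 1..q + m} = {q + m + 1..q + m + m}"
      by (simp add: image_add_atLeastAtMost')
    finally show ?thesis .
  qed
  ultimately have \<beta>_img: "\<beta> ` {q + 1..q + m} = {1..m}" by simp
  \<comment> \<open>The involution sends the top \<open>m\<close> positions back to
    \<open>{1..m}\<close>, so the middle block occupies the remaining values of \<beta> and a second
    cut is possible.\<close>
  have "\<beta> ` {1..q} = \<beta> ` ({1..q + m} - {q + 1..q + m})"
    by (rule arg_cong[of _ _ "\<lambda>A. \<beta> ` A"]) auto
  also have "\<dots> = {1..q + m} - {1..m}"
    using permutes_image[OF \<beta>] by (simp add: image_set_diff[OF permutes_inj[OF \<beta>]] \<beta>_img del: One_nat_def)
  also have "\<dots> = {m + 1..m + q}" by auto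
  finally obtain \<tau> \<sigma>' where \<tau>: "\<tau> permutes {1..q}" and \<sigma>': "\<sigma>' permutes {1..m}"
    and \<beta>_eq: "\<beta> = skew q m \<tau> \<sigma>'"
    using skew_split[OF \<beta>] by blast
  have "\<alpha> = inv (skew m (q + m) \<sigma> \<beta>)" using invol \<alpha>_eq by simp
  also have "\<dots> = skew (q + m) m (inv \<beta>) (inv \<sigma>)" by (rule skew_inv[OF \<sigma> \<beta>])
  also have "inv \<beta> = skew m q (inv \<sigma>') (inv \<tau>)" unfolding \<beta>_eq by (rule skew_inv[OF \<tau> \<sigma>'])
  also have "skew (q + m) m (skew m q (inv \<sigma>') (inv \<tau>)) (inv \<sigma>)
      = skew m (q + m) (inv \<sigma>') (skew q m (inv \<tau>) (inv \<sigma>))"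
    using skew_assoc[OF permutes_inv[OF \<sigma>'] permutes_inv[OF \<tau>] permutes_inv[OF \<sigma>]]
    by (simp add: add.commute)
  finally have eq: "skew m (q + m) \<sigma> \<beta> = skew m (q + m) (inv \<sigma>') (skew q m (inv \<tau>) (inv \<sigma>))"
    using \<alpha>_eq by simp
  note perms = \<sigma> \<tau> \<sigma>' \<beta> permutes_inv[OF \<sigma>] permutes_inv[OF \<tau>] permutes_inv[OF \<sigma>']
  have "\<beta> = skew q m (inv \<tau>) (inv \<sigma>)"
    by (rule skew_inject(2)[OF _ _ _ _ eq]) (intro perms skew_permutes)+
  then have eq2: "skew q m \<tau> \<sigma>' = skew q m (inv \<tau>) (inv \<sigma>)" using \<beta>_eq by simp
  have "\<tau> = inv \<tau>" by (rule skew_inject(1)[OF _ _ _ _ eq2]) (intro perms)+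
  moreover have "\<sigma>' = inv \<sigma>" by (rule skew_inject(2)[OF _ _ _ _ eq2]) (intro perms)+
  ultimately show ?thesis using that[OF \<sigma> \<tau>] \<alpha>_eq \<beta>_eq by (simp add: blk_def)
qed

text \<open>For a permutation of \<open>{1..n}\<close> with \<open>\<alpha> m = n\<close>, this says
  that the maximum value takes part in no 132, where it could only be the middle entry.\<close>

definition sep :: "(nat \<Rightarrow> nat) \<Rightarrow> nat \<Rightarrow> nat \<Rightarrow> bool" where
  "sep \<alpha> m n \<longleftrightarrow> (\<forall>l\<in>{1..m}. \<forall>r\<in>{m + 1..n}. \<alpha> r < \<alpha> l)"

lemma bij_betw_blk:
  assumes "1 \<le> m"
  shows "bij_betw (\<lambda>(\<sigma>, \<tau>). blk m q \<sigma> \<tau>) (D_set k m \<times> J_set k q)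
    {\<alpha> \<in> J_set k (m + (q + m)). \<alpha> (m + (q + m)) = m \<and> sep \<alpha> m (m + (q + m))}"
    (is "bij_betw ?f ?A ?B")
  unfolding bij_betw_def
proof
  show "inj_on ?f ?A"
  proof (rule inj_onI, clarify)
    fix \<sigma> \<rho> \<sigma>' \<rho>'
    assume *: "\<sigma> \<in> D_set k m" "\<rho> \<in> J_set k q" "\<sigma>' \<in> D_set k m" "\<rho>' \<in> J_set k q"
      and eq: "blk m q \<sigma> \<rho> = blk m q \<sigma>' \<rho>'"
    show "\<sigma> = \<sigma>' \<and> \<rho> = \<rho>'"
      using blk_inject[OF _ _ _ _ eq] * by (simp add: D_set_def C_set_def J_set_def)
  qed
  \<comment> \<open>Hence the condition that the last value is \<open>m\<close> expresses that
    \<sigma> ends with its maximum.\<close>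
  have last: "blk m q \<sigma> \<tau> (m + (q + m)) = inv \<sigma> m" for \<sigma> \<tau>
    unfolding blk_def using assms by (simp add: skew_last)
  show "?f ` ?A = ?B"
  proof
    show "?f ` ?A \<subseteq> ?B"
    proof clarify
      fix \<sigma> \<tau> assume \<sigma>: "\<sigma> \<in> D_set k m" and \<tau>: "\<tau> \<in> J_set k q"
      then have p: "\<sigma> permutes {1..m}" "\<tau> permutes {1..q}"
        by (auto simp: D_set_def C_set_def J_set_def)
      have "\<sigma> m = m" using \<sigma> by (simp add: D_set_def)
      then have "inv \<sigma> m = m" using permutes_inverses(2)[OF p(1), of m] by simp
      moreover have "sep (blk m q \<sigma> \<tau>) m (m + (q + m))"
        unfolding sep_def blk_def
        using skew_antitone[OF p(1) skew_permutes[OF p(2) permutes_inv[OF p(1)]]] by blast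
      ultimately show "blk m q \<sigma> \<tau> \<in> J_set k (m + (q + m)) \<and>
          blk m q \<sigma> \<tau> (m + (q + m)) = m \<and> sep (blk m q \<sigma> \<tau>) m (m + (q + m))"
        using \<sigma> \<tau> blk_permutes[OF p] blk_inv[OF p] inc_blk[OF p] card_occ_blk[OF p] last
        unfolding D_set_def C_set_def J_set_def by simp
    qed
    show "?B \<subseteq> ?f ` ?A"
    proof clarify
      fix \<alpha> assume \<alpha>: "\<alpha> \<in> J_set k (m + (q + m))" and m: "\<alpha> (m + (q + m)) = m"
        and sep: "sep \<alpha> m (m + (q + m))"
      have perm: "\<alpha> permutes {1..m + (q + m)}" and invol: "inv \<alpha> = \<alpha>"
        using \<alpha> by (simp_all add: J_set_def)
      have "\<alpha> ` {1..m} = {q + m + 1..q + m + m}"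
        using image_top_block[OF perm, of m] sep unfolding sep_def by (simp add: ac_simps)
      then obtain \<sigma> \<tau> where *: "\<sigma> permutes {1..m}" "\<tau> permutes {1..q}" "inv \<tau> = \<tau>" "\<alpha> = blk m q \<sigma> \<tau>"
        using blk_split[OF perm invol] by metis
      have "\<sigma> m = m" using m last[of \<sigma> \<tau>] permutes_inverses(1)[OF *(1), of m] *(4) by simp
      moreover have "card (occ \<sigma> {1..m}) = 0" "card (occ \<tau> {1..q}) = 1"
        using \<alpha> card_occ_blk[OF *(1,2), folded *(4)] unfolding J_set_def mem_Collect_eq by presburger+
      ultimately have "\<sigma> \<in> D_set k m" "\<tau> \<in> J_set k q"
        using * \<alpha> assms inc_blk[OF *(1,2)] by (simp_all add: D_set_def C_set_def J_set_def)
      with * show "\<alpha> \<in> ?f ` ?A" by force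
    qed
  qed
qed

section \<open>Counting the involutions whose maximum lies outside the occurrence\<close>

lemma J_setD:
  assumes "\<alpha> \<in> J_set k n"
  shows "\<alpha> permutes {1..n}" "inv \<alpha> = \<alpha>" "\<alpha> (\<alpha> x) = x" "\<alpha> x = \<alpha> y \<longleftrightarrow> x = y"
proof -
  show p: "\<alpha> permutes {1..n}" and i: "inv \<alpha> = \<alpha>" using assms by (simp_all add: J_set_def)
  show "\<alpha> (\<alpha> x) = x" using permutes_inverses(1)[OF p] i by simp
  show "\<alpha> x = \<alpha> y \<longleftrightarrow> x = y" using inj_eq[OF permutes_inj[OF p]] .
qed

text \<open>If \<open>2 * m > n\<close>, the top \<open>m\<close> values, taken on
  \<open>{1..m}\<close>, would include \<open>m\<close>, which is already taken at position
  \<open>n > m\<close>.\<close>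

lemma card_J_sep:
  assumes "1 \<le> m" "m < n"
  shows "card {\<alpha> \<in> J_set k n. \<alpha> n = m \<and> sep \<alpha> m n}
    = (if 2 * m \<le> n then card (D_set k m) * card (J_set k (n - 2 * m)) else 0)"
proof (cases "2 * m \<le> n")
  case True
  then have "m + (n - 2 * m + m) = n" by simp
  with bij_betw_same_card[OF bij_betw_blk[OF assms(1), of "n - 2 * m" k]] True show ?thesis
    by (simp add: card_cartesian_product)
next
  case False
  have "\<not> (\<alpha> n = m \<and> sep \<alpha> m n)" if \<alpha>: "\<alpha> \<in> J_set k n" for \<alpha>
  proof
    assume *: "\<alpha> n = m \<and> sep \<alpha> m n"
    have "\<alpha> ` {1..m} = {n - m + 1..n}"
      using image_top_block[OF J_setD(1)[OF \<alpha>], of m] * assms unfolding sep_def by simp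
    then have "m \<in> \<alpha> ` {1..m}" using False assms by auto
    then obtain x where "x \<in> {1..m}" "\<alpha> x = m" by auto
    then show False using * J_setD(4)[OF \<alpha>, of x n] assms by auto
  qed
  then have "{\<alpha> \<in> J_set k n. \<alpha> n = m \<and> sep \<alpha> m n} = {}" by blast
  then show ?thesis using False by (simp only: card.empty if_False)
qed

text \<open>In \<open>blk p 1 \<sigma> id\<close> with \<open>\<sigma> p = p\<close>, the point
  \<open>p + 1\<close> is fixed and \<open>p\<close> is swapped with \<open>2 * p + 1\<close>.
  Conjugation exchanges the roles of \<open>p\<close> and \<open>p + 1\<close>, so that
  \<open>p\<close>, \<open>p + 1\<close>, \<open>2 * p + 1\<close> become a 132.\<close>

definition insert_fix :: "nat \<Rightarrow> (nat \<Rightarrow> nat) \<Rightarrow> nat \<Rightarrow> nat" where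
  "insert_fix p \<sigma> = transpose p (p + 1) \<circ> blk p 1 \<sigma> id \<circ> transpose p (p + 1)"

section \<open>Triples and increasing sets in \<open>insert_fix p \<sigma>\<close>\<close>

context
  fixes p :: nat and \<sigma> :: "nat \<Rightarrow> nat" and \<alpha> :: "nat \<Rightarrow> nat"
  assumes p: "1 \<le> p" and \<sigma>: "\<sigma> permutes {1..p}" and \<sigma>p: "\<sigma> p = p"
  defines "\<alpha> \<equiv> insert_fix p \<sigma>"
begin

private lemma transpose_permutes: "transpose p (p + 1) permutes {1..p + (1 + p)}"
  using p by (intro permutes_swap_id) auto

lemma insert_fix_permutes: "insert_fix p \<sigma> permutes {1..p + (1 + p)}"
  unfolding insert_fix_def
  by (intro permutes_compose transpose_permutes blk_permutes \<sigma> permutes_id)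

lemma insert_fix_inv: "inv (insert_fix p \<sigma>) = insert_fix p \<sigma>"
proof -
  let ?t = "transpose p (p + 1)" and ?b = "blk p 1 \<sigma> id"
  have b: "?b permutes {1..p + (1 + p)}" by (intro blk_permutes \<sigma> permutes_id)
  have "inv ?b = ?b" using blk_inv[OF \<sigma> permutes_id, of 1] by simp
  then have "?b (?b x) = x" for x using permutes_inverses(1)[OF b, of x] by simp
  then have "insert_fix p \<sigma> \<circ> insert_fix p \<sigma> = id"
    by (auto simp: insert_fix_def fun_eq_iff)
  then show ?thesis by (intro inv_unique_comp)
qed

private lemma \<alpha>_left: "1 \<le> x \<Longrightarrow> x \<le> p \<Longrightarrow> \<alpha> (transpose p (p + 1) x) = \<sigma> x + (p + 1)"
  using permutes_range[OF \<sigma>, of x]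
  by (simp add: \<alpha>_def insert_fix_def blk_def skew_def)

private lemma \<alpha>_mid: "\<alpha> p = p"
  by (simp add: \<alpha>_def insert_fix_def blk_def skew_def)

private lemma \<alpha>_right:
  "1 \<le> x \<Longrightarrow> x \<le> p \<Longrightarrow> \<alpha> (x + (p + 1)) = transpose p (p + 1) (inv \<sigma> x)"
  using p by (simp add: \<alpha>_def insert_fix_def blk_def skew_def)

private lemma \<alpha>_Suc: "\<alpha> (p + 1) = p + (1 + p)"
  using \<alpha>_left[of p] p \<sigma>p by simp

private lemma \<alpha>_last: "\<alpha> (p + (1 + p)) = p + 1"
  using \<alpha>_right[of p] p \<sigma>p permutes_inverses(2)[OF \<sigma>, of p] by (simp add: add.commute)

text \<open>On \<open>{1..p}\<close> the transposition only lifts \<open>p\<close> to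
  \<open>p + 1\<close>. It therefore disturbs neither the order of the positions in the left block
  nor that of the values in the right block.\<close>

private lemma transpose_mono: "strict_mono_on {1..p} (transpose p (p + 1))"
  by (auto simp: strict_mono_on_def transpose_def)

private lemma left_image: "{1..p + 1} - {p} = transpose p (p + 1) ` {1..p}"
  using p by (auto simp: transpose_def image_iff)

private lemma right_image: "{p + 2..p + (1 + p)} = (\<lambda>x. x + (p + 1)) ` {1..p}"
proof -
  have "{p + 2..p + (1 + p)} = {1 + (p + 1)..p + (p + 1)}" by simp
  also have "\<dots> = (\<lambda>x. x + (p + 1)) ` {1..p}" by (rule image_add_atLeastAtMost'[symmetric])
  finally show ?thesis .
qed

private lemma \<alpha>_left_gt:
  assumes "x \<in> {1..p + 1} - {p}"
  shows "p + 1 < \<alpha> x"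
proof -
  obtain y where "y \<in> {1..p}" "x = transpose p (p + 1) y" using assms left_image by blast
  then show ?thesis using \<alpha>_left[of y] permutes_range(1)[OF \<sigma>, of y] by auto
qed

text \<open>In the right block only the last position has a value above \<open>p\<close>; this
  limits what can follow the fixed point \<open>p\<close> in a pattern.\<close>

private lemma \<alpha>_right_le:
  assumes "x \<in> {p + 2..p + (1 + p)}"
  shows "\<alpha> x \<le> p + 1" "x \<noteq> p + (1 + p) \<Longrightarrow> \<alpha> x < p"
proof -
  obtain y where y: "y \<in> {1..p}" "x = y + (p + 1)" using assms right_image by blast
  have i: "inv \<sigma> y \<le> p" using permutes_range(2)[OF permutes_inv[OF \<sigma>], of y] y by auto
  then show "\<alpha> x \<le> p + 1" using \<alpha>_right[of y] y by (auto simp: transpose_def)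
  assume "x \<noteq> p + (1 + p)"
  then have "y \<noteq> p" using y by auto
  then have "inv \<sigma> y \<noteq> p" using permutes_inverses(1)[OF \<sigma>, of y] \<sigma>p by auto
  with i show "\<alpha> x < p" using \<alpha>_right[of y] y by (auto simp: transpose_def)
qed

private lemma \<alpha>_antitone:
  assumes "x \<in> {1..p + 1} - {p}" "y \<in> {p + 2..p + (1 + p)}"
  shows "x < y \<and> \<alpha> y < \<alpha> x"
  using \<alpha>_left_gt[OF assms(1)] \<alpha>_right_le(1)[OF assms(2)] assms by auto

private lemma card_occ_left: "card (occ \<alpha> ({1..p + 1} - {p})) = card (occ \<sigma> {1..p})"
  unfolding left_image card_occ_image[OF transpose_mono]
  by (intro arg_cong[of _ _ card] occ_cong) (simp del: One_nat_def add: \<alpha>_left)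

private lemma inc_left: "inc k \<alpha> ({1..p + 1} - {p}) = inc k \<sigma> {1..p}"
  unfolding left_image inc_image[OF transpose_mono]
  by (intro inc_cong) (simp del: One_nat_def add: \<alpha>_left)

private lemma \<alpha>_right_less:
  assumes "x \<in> {1..p}" "y \<in> {1..p}"
  shows "(\<alpha> \<circ> (\<lambda>x. x + (p + 1))) x < (\<alpha> \<circ> (\<lambda>x. x + (p + 1))) y \<longleftrightarrow> inv \<sigma> x < inv \<sigma> y"
proof -
  have "inv \<sigma> x \<in> {1..p}" "inv \<sigma> y \<in> {1..p}"
    using assms permutes_in_image[OF permutes_inv[OF \<sigma>]] by blast+
  from strict_mono_on_less[OF transpose_mono this] show ?thesis
    using assms \<alpha>_right by simp
qed

private lemma shift_mono: "strict_mono_on {1..p} (\<lambda>x. x + (p + 1))"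
  by (simp add: strict_mono_on_def)

private lemma card_occ_right: "card (occ \<alpha> {p + 2..p + (1 + p)}) = card (occ \<sigma> {1..p})"
  unfolding right_image card_occ_image[OF shift_mono] card_occ_inv[OF \<sigma>, symmetric]
  by (rule arg_cong[of _ _ card], rule occ_cong, rule \<alpha>_right_less)

private lemma inc_right: "inc k \<alpha> {p + 2..p + (1 + p)} = inc k \<sigma> {1..p}"
  unfolding right_image inc_image[OF shift_mono] inc_inv[OF \<sigma>, symmetric]
  by (rule inc_cong, rule \<alpha>_right_less)

private lemma without_p:
  "{1..p + (1 + p)} - {p} = ({1..p + 1} - {p}) \<union> {p + 2..p + (1 + p)}"
  by auto

text \<open>Triples that miss \<open>p\<close> lie in one of two blocks, each order-equivalent to
  \<sigma> or its inverse. Exactly one triple passes through \<open>p\<close>.\<close>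

lemma card_occ_insert_fix:
  "card (occ (insert_fix p \<sigma>) {1..p + (1 + p)}) = Suc (2 * card (occ \<sigma> {1..p}))"
proof -
  let ?X = "{1..p + (1 + p)}"
  have "(p, p + 1, p + (1 + p)) \<in> occ \<alpha> ?X"
    using p \<alpha>_mid \<alpha>_Suc \<alpha>_last by (auto simp: occ_def)
  moreover have "(a, b, c) = (p, p + 1, p + (1 + p))"
    if "(a, b, c) \<in> occ \<alpha> ?X" "(a, b, c) \<notin> occ \<alpha> (?X - {p})" for a b c
  proof -
    have abc: "a \<in> ?X" "b \<in> ?X" "c \<in> ?X" "a < b" "b < c" "\<alpha> a < \<alpha> c" "\<alpha> c < \<alpha> b"
      and "a = p \<or> b = p \<or> c = p" using that by (auto simp: occ_def)
    \<comment> \<open>The first entry of a 132 has the smallest value, so a first entry left of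
      \<open>p\<close> would have to lie below the value \<open>p\<close>.\<close>
    moreover have "p + 1 < \<alpha> a" if "a < p" using \<alpha>_left_gt[of a] abc that by auto
    ultimately have "a = p" using \<alpha>_mid by auto
    then have *: "p < \<alpha> b" "p < \<alpha> c" using abc \<alpha>_mid by auto
    have "x = p + 1 \<or> x = p + (1 + p)" if "p < x" "x \<in> ?X" "p < \<alpha> x" for x
      using \<alpha>_right_le(2)[of x] that by force
    from this[of b] this[of c] have "b = p + 1" "c = p + (1 + p)"
      using abc * \<open>a = p\<close> by auto
    with \<open>a = p\<close> show ?thesis by simp
  qed
  moreover have "occ \<alpha> (?X - {p}) \<subseteq> occ \<alpha> ?X" by (auto simp: occ_def)
  ultimately have "occ \<alpha> ?X = insert (p, p + 1, p + (1 + p)) (occ \<alpha> (?X - {p}))" by fast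
  moreover have "(p, p + 1, p + (1 + p)) \<notin> occ \<alpha> (?X - {p})" by (simp add: occ_def)
  ultimately have "card (occ \<alpha> ?X) = Suc (card (occ \<alpha> (?X - {p})))"
    by (simp add: finite_occ del: One_nat_def)
  also have "card (occ \<alpha> (?X - {p})) = 2 * card (occ \<sigma> {1..p})"
    unfolding without_p using card_occ_antitone_union[of "{1..p + 1} - {p}" "{p + 2..p + (1 + p)}", OF \<alpha>_antitone] card_occ_left card_occ_right
    by (simp del: One_nat_def)
  finally show ?thesis by (simp add: \<alpha>_def)
qed

text \<open>An increasing set through \<open>p\<close> lies in \<open>{p, p + 1, 2 * p + 1}\<close>,
  and the last two positions form a descent. It has at most two elements, fewer than
  \<open>k\<close>.\<close>

lemma inc_insert_fix:
  assumes "3 \<le> k"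
  shows "inc k (insert_fix p \<sigma>) {1..p + (1 + p)} \<longleftrightarrow> inc k \<sigma> {1..p}"
proof -
  let ?X = "{1..p + (1 + p)}"
  have "p \<notin> S" if S: "S \<subseteq> ?X" "card S = k" "strict_mono_on S \<alpha>" for S
  proof
    assume "p \<in> S"
    have "x = p \<or> x = p + 1 \<or> x = p + (1 + p)" if "x \<in> S" for x
    proof -
      have x: "x \<in> ?X" using that S(1) by blast
      consider "x < p" | "x = p" | "p < x" by linarith
      then show ?thesis
      proof cases
        case 1
        then have "\<alpha> x < \<alpha> p" using strict_mono_onD[OF S(3) that \<open>p \<in> S\<close>] by simp
        then show ?thesis using \<alpha>_left_gt[of x] 1 x \<alpha>_mid by auto
      next
        case 3
        then have "\<alpha> p < \<alpha> x" using strict_mono_onD[OF S(3) \<open>p \<in> S\<close> that] by simp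
        then show ?thesis using \<alpha>_right_le(2)[of x] 3 x \<alpha>_mid by force
      qed simp
    qed
    then have sub: "S \<subseteq> {p, p + 1, p + (1 + p)}" by blast
    moreover have "\<not> (p + 1 \<in> S \<and> p + (1 + p) \<in> S)"
      using strict_mono_onD[OF S(3), of "p + 1" "p + (1 + p)"] \<alpha>_Suc \<alpha>_last p by auto
    ultimately have "S \<subseteq> {p, p + 1} \<or> S \<subseteq> {p, p + (1 + p)}" by blast
    then have "card S \<le> 2" by (auto dest: card_mono[rotated] simp: card_insert_if)
    with S(2) assms show False by simp
  qed
  then have "S \<subseteq> ?X \<longleftrightarrow> S \<subseteq> ?X - {p}" if "card S = k" "strict_mono_on S \<alpha>" for S
    using that by blast
  then have "inc k \<alpha> ?X \<longleftrightarrow> inc k \<alpha> (?X - {p})" unfolding inc_def by metis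
  also have "\<dots> \<longleftrightarrow> inc k \<sigma> {1..p}"
    unfolding without_p using inc_antitone_union[of "{1..p + 1} - {p}" "{p + 2..p + (1 + p)}", OF \<alpha>_antitone]
      inc_left inc_right by simp
  finally show ?thesis by (simp add: \<alpha>_def)
qed

lemma insert_fix_last: "insert_fix p \<sigma> (p + (1 + p)) = p + 1"
  using \<alpha>_last by (simp add: \<alpha>_def)

lemma not_sep_insert_fix: "\<not> sep (insert_fix p \<sigma>) (p + 1) (p + (1 + p))"
proof
  assume "sep (insert_fix p \<sigma>) (p + 1) (p + (1 + p))"
  then have "\<alpha> (p + (1 + p)) < \<alpha> p" using p unfolding sep_def \<alpha>_def by auto
  then show False using \<alpha>_last \<alpha>_mid by simp
qed

end

text \<open>
  The inverse of a permutation maps 132-occurrences to 132-occurrences, so the only occurrence in an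
  involution is mapped to itself: it consists of a fixed point followed by a transposed pair.
\<close>
lemma not_sep_structure:
  assumes \<alpha>: "\<alpha> \<in> J_set k n" and lt: "\<alpha> n < n" and not_sep: "\<not> sep \<alpha> (\<alpha> n) n"
  obtains p where "1 \<le> p" "n = p + (1 + p)" "\<alpha> n = p + 1" "\<alpha> ` ({1..p + 1} - {p}) = {p + 2..p + (1 + p)}"
proof -
  note perm = J_setD(1)[OF \<alpha>] and \<alpha>\<alpha> = J_setD(3)[OF \<alpha>] and \<alpha>_eq = J_setD(4)[OF \<alpha>]
  define m where "m = \<alpha> n"
  have m: "1 \<le> m" "m < n" "\<alpha> n = m" "\<alpha> m = n"
    using lt permutes_range(1)[OF perm, of n] \<alpha>\<alpha>[of n] by (auto simp: m_def)
  have card1: "card (occ \<alpha> {1..n}) = 1" using \<alpha> by (simp add: J_set_def)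
  \<comment> \<open>A pair violating separation makes \<open>(l, m, r)\<close> a 132. Inversion
    turns it into the 132 \<open>(\<alpha> l, \<alpha> r, n)\<close>, and uniqueness makes the two
    equal.\<close>
  have key: "\<alpha> l = l \<and> r = n \<and> occ \<alpha> {1..n} = {(l, m, n)}"
    if l: "l \<in> {1..m}" and r: "r \<in> {m + 1..n}" and "\<not> \<alpha> r < \<alpha> l" for l r
  proof -
    have neq: "\<alpha> l \<noteq> \<alpha> r" "\<alpha> r \<noteq> \<alpha> m" using l r \<alpha>_eq by auto
    have bounds: "\<alpha> r \<le> n" "\<alpha> r \<ge> 1" "\<alpha> l \<ge> 1" "\<alpha> l \<le> n"
      using permutes_range[OF perm] l r m by auto
    then have "l \<noteq> m" using neq m that by auto
    then have occ1: "(l, m, r) \<in> occ \<alpha> {1..n}"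
      using l r m neq bounds that(3) by (auto simp: occ_def)
    then have occ2: "(\<alpha> l, \<alpha> r, n) \<in> occ \<alpha> {1..n}"
      using bounds m \<alpha>\<alpha> by (auto simp: occ_def)
    obtain t where t: "occ \<alpha> {1..n} = {t}" using card1 by (auto simp: card_1_singleton_iff)
    with occ1 occ2 have "(l, m, r) = (\<alpha> l, \<alpha> r, n)" by auto
    then show ?thesis using t occ1 by auto
  qed
  obtain l r where lr: "l \<in> {1..m}" "r \<in> {m + 1..n}" "\<not> \<alpha> r < \<alpha> l"
    using not_sep unfolding sep_def m_def by blast
  have l: "\<alpha> l = l" and occ_eq: "occ \<alpha> {1..n} = {(l, m, n)}" using key[OF lr] by auto
  have "l \<noteq> m" using l m by auto
  then have "l < m" "1 \<le> l" using lr by auto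
  \<comment> \<open>Thus \<open>(l, n)\<close> is the only violating pair; comparing every other
    position with \<open>n\<close> or with \<open>l\<close> locates all remaining values.\<close>
  have less: "\<alpha> r' < \<alpha> l'" if "l' \<in> {1..m}" "r' \<in> {m + 1..n}" "l' \<noteq> l \<or> r' \<noteq> n" for l' r'
    using key[OF that(1,2)] occ_eq that(3) by auto
  have big: "m < \<alpha> x" if "x \<in> {1..m} - {l}" for x
    using less[of x n] that m by auto
  have small: "\<alpha> x < l" if "x \<in> {m + 1..n - 1}" for x
    using less[of l x] that lr l by auto
  have preimage: "\<exists>x\<in>{1..n}. \<alpha> x = y" if "y \<in> {1..n}" for y
    using permutes_image[OF perm] that by (metis imageE)
  have split: "x \<in> {1..m} - {l} \<or> x = l \<or> x \<in> {m + 1..n - 1} \<or> x = n" if "x \<in> {1..n}" for x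
    using that by auto
  have top: "\<alpha> ` ({1..m} - {l}) = {m + 1..n}"
  proof
    show "\<alpha> ` ({1..m} - {l}) \<subseteq> {m + 1..n}"
      using big permutes_range(2)[OF perm] m by force
    show "{m + 1..n} \<subseteq> \<alpha> ` ({1..m} - {l})"
    proof
      fix y assume y: "y \<in> {m + 1..n}"
      then obtain x where "x \<in> {1..n}" "\<alpha> x = y" using preimage[of y] by auto
      moreover then have "x \<in> {1..m} - {l}"
        using split[of x] small[of x] y l m \<open>l < m\<close> by auto
      ultimately show "y \<in> \<alpha> ` ({1..m} - {l})" by blast
    qed
  qed
  have bottom: "\<alpha> ` {m + 1..n - 1} = {1..l - 1}"
  proof
    show "\<alpha> ` {m + 1..n - 1} \<subseteq> {1..l - 1}"
      using small permutes_range(1)[OF perm] m by fastforce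
    show "{1..l - 1} \<subseteq> \<alpha> ` {m + 1..n - 1}"
    proof
      fix y assume y: "y \<in> {1..l - 1}"
      then have "y \<in> {1..n}" using \<open>l < m\<close> m(2) by auto
      then obtain x where "x \<in> {1..n}" "\<alpha> x = y" using preimage[of y] by auto
      moreover then have "x \<in> {m + 1..n - 1}"
        using split[of x] big[of x] y l m \<open>l < m\<close> by auto
      ultimately show "y \<in> \<alpha> ` {m + 1..n - 1}" by blast
    qed
  qed
  have inj: "inj_on \<alpha> A" for A using permutes_inj_on[OF perm] .
  \<comment> \<open>Counting both images determines \<open>m\<close> and \<open>n\<close> in terms
    of \<open>l\<close>.\<close>
  have "card ({1..m} - {l}) = card {m + 1..n}" using top card_image[OF inj] by metis
  then have "m - 1 = n - m" using lr(1) by simp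
  moreover have "card {m + 1..n - 1} = card {1..l - 1}" using bottom card_image[OF inj] by metis
  then have "n - 1 - m = l - 1" by simp
  ultimately have "m = l + 1" "n = l + (1 + l)" using m \<open>l < m\<close> \<open>1 \<le> l\<close> by auto
  then show ?thesis using that[of l] top m \<open>1 \<le> l\<close> by simp
qed

lemma bij_betw_insert_fix:
  assumes p: "1 \<le> p" and k: "3 \<le> k"
  shows "bij_betw (insert_fix p) (D_set k p)
    {\<alpha> \<in> J_set k (p + (1 + p)). \<alpha> (p + (1 + p)) < p + (1 + p) \<and> \<not> sep \<alpha> (\<alpha> (p + (1 + p))) (p + (1 + p))}"
    (is "bij_betw _ ?A ?B")
  unfolding bij_betw_def
proof
  let ?n = "p + (1 + p)" and ?t = "transpose p (p + 1)"
  show "inj_on (insert_fix p) ?A"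
  proof (rule inj_onI)
    fix \<sigma> \<sigma>' assume *: "\<sigma> \<in> ?A" "\<sigma>' \<in> ?A" and eq: "insert_fix p \<sigma> = insert_fix p \<sigma>'"
    have "blk p 1 \<rho> id = ?t \<circ> insert_fix p \<rho> \<circ> ?t" for \<rho>
      by (simp add: insert_fix_def fun_eq_iff)
    with eq have "blk p 1 \<sigma> id = blk p 1 \<sigma>' id" by metis
    with * show "\<sigma> = \<sigma>'"
      by (intro blk_inject(1)[of \<sigma> p id 1 \<sigma>' id]) (auto simp: D_set_def C_set_def permutes_id)
  qed
  show "insert_fix p ` ?A = ?B"
  proof
    show "insert_fix p ` ?A \<subseteq> ?B"
    proof clarify
      fix \<sigma> assume \<sigma>: "\<sigma> \<in> ?A"
      then have *: "\<sigma> permutes {1..p}" "\<sigma> p = p" by (auto simp: D_set_def C_set_def)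
      show "insert_fix p \<sigma> \<in> J_set k ?n \<and> insert_fix p \<sigma> ?n < ?n
          \<and> \<not> sep (insert_fix p \<sigma>) (insert_fix p \<sigma> ?n) ?n"
        using \<sigma> insert_fix_permutes[OF p *] insert_fix_inv[OF p *] card_occ_insert_fix[OF p *]
          inc_insert_fix[OF p * k] not_sep_insert_fix[OF p *] p
        unfolding J_set_def D_set_def C_set_def insert_fix_last[OF p *] by simp
    qed
    show "?B \<subseteq> insert_fix p ` ?A"
    proof clarify
      fix \<alpha> assume \<alpha>: "\<alpha> \<in> J_set k ?n" and lt: "\<alpha> ?n < ?n" and ns: "\<not> sep \<alpha> (\<alpha> ?n) ?n"
      obtain p' where "?n = p' + (1 + p')" "\<alpha> ?n = p' + 1"
        "\<alpha> ` ({1..p' + 1} - {p'}) = {p' + 2..p' + (1 + p')}"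
        using not_sep_structure[OF \<alpha> lt ns] by metis
      moreover from this have "p' = p" by simp
      ultimately have last: "\<alpha> ?n = p + 1" and img: "\<alpha> ` ({1..p + 1} - {p}) = {p + 2..?n}" by auto
      \<comment> \<open>Conjugating once more by the same transposition recovers the skew sum;
        \<open>?t\<close> moves no point above \<open>p + 1\<close>, so the values in the top block
        stay in place.\<close>
      define \<beta> where "\<beta> = ?t \<circ> \<alpha> \<circ> ?t"
      have \<alpha>_eq: "\<alpha> = ?t \<circ> \<beta> \<circ> ?t" by (simp add: \<beta>_def fun_eq_iff)
      have t: "?t permutes {1..?n}" using p by (intro permutes_swap_id) auto
      have \<beta>: "\<beta> permutes {1..?n}"
        unfolding \<beta>_def by (intro permutes_compose t J_setD(1)[OF \<alpha>])
      have "\<beta> \<circ> \<beta> = id" using J_setD(3)[OF \<alpha>] by (simp add: \<beta>_def fun_eq_iff)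
      then have invol: "inv \<beta> = \<beta>" by (intro inv_unique_comp)
      have "\<beta> ` {1..p} = ?t ` \<alpha> ` ?t ` {1..p}" by (simp only: \<beta>_def image_comp comp_assoc)
      also have "?t ` {1..p} = {1..p + 1} - {p}"
        using p by (auto simp: transpose_def image_iff)
      also have "?t ` \<alpha> ` ({1..p + 1} - {p}) = ?t ` {p + 2..?n}" by (simp only: img)
      also have "\<dots> = id ` {p + 2..?n}" by (rule image_cong) (auto simp: transpose_def)
      finally have "\<beta> ` {1..p} = {1 + p + 1..1 + p + p}" by (simp add: add.commute)
      then obtain \<sigma> \<tau> where \<sigma>: "\<sigma> permutes {1..p}" and \<tau>: "\<tau> permutes {1..1}"
        and \<beta>_eq: "\<beta> = blk p 1 \<sigma> \<tau>"
        using blk_split[OF \<beta> invol] by metis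
      have "\<tau> = id" using \<tau> by simp
      then have \<alpha>_fix: "\<alpha> = insert_fix p \<sigma>" using \<alpha>_eq \<beta>_eq by (simp add: insert_fix_def)
      \<comment> \<open>The last value of the skew sum is also \<open>inv \<sigma> p\<close>, so
        \<sigma> ends with its maximum.\<close>
      have "\<beta> ?n = p" using last p by (simp add: \<beta>_def transpose_def)
      moreover have "\<beta> ?n = inv \<sigma> p" unfolding \<beta>_eq blk_def
        by (simp only: skew_last[OF p] skew_last[OF le_add1[of 1 p]])
      ultimately have "\<sigma> p = p" using permutes_inverses(1)[OF \<sigma>, of p] by simp
      then have "\<sigma> \<in> ?A"
        using \<alpha> \<sigma> p card_occ_insert_fix[OF p \<sigma>] inc_insert_fix[OF p \<sigma> _ k]
        unfolding \<alpha>_fix J_set_def D_set_def C_set_def by simp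
      then show "\<alpha> \<in> insert_fix p ` ?A" using \<alpha>_fix by blast
    qed
  qed
qed

section \<open>Recurrence for the number of involutions with one 132\<close>

lemma card_J_not_sep:
  assumes "3 \<le> k"
  shows "card {\<alpha> \<in> J_set k n. \<alpha> n < n \<and> \<not> sep \<alpha> (\<alpha> n) n}
    = (if odd n then card (D_set k (n div 2)) else 0)"
proof (cases "\<exists>p. 1 \<le> p \<and> n = p + (1 + p)")
  case True
  then obtain p where p: "1 \<le> p" "n = p + (1 + p)" by blast
  moreover then have "odd n" "n div 2 = p" by simp_all
  ultimately show ?thesis using bij_betw_same_card[OF bij_betw_insert_fix[OF p(1) assms]] by simp
next
  case False
  have empty: "{\<alpha> \<in> J_set k n. \<alpha> n < n \<and> \<not> sep \<alpha> (\<alpha> n) n} = {}"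
    using False not_sep_structure by (metis (mono_tags, lifting) Collect_empty_eq)
  \<comment> \<open>The only odd length left is 1, where the formula gives 0 because
    \<open>D_set k 0\<close> is empty.\<close>
  have "n div 2 = 0" if "odd n"
  proof (rule ccontr)
    assume "n div 2 \<noteq> 0"
    moreover have "n = n div 2 + (1 + n div 2)" using that by presburger
    ultimately show False using False by (metis One_nat_def Suc_leI neq0_conv)
  qed
  then show ?thesis unfolding empty by (simp add: D_set_0)
qed

lemma J_set_fixed_last: "{\<alpha> \<in> J_set (Suc k) (Suc n). \<alpha> (Suc n) = Suc n} = J_set k n"
proof -
  have "f \<in> J_set (Suc k) (Suc n) \<and> f (Suc n) = Suc n \<longleftrightarrow> f \<in> J_set k n" for f
  proof (cases "f permutes {1..Suc n} \<and> f (Suc n) = Suc n")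
    case True
    then show ?thesis
      using permutes_fixed_max[of "Suc n" f] occ_fixed_max[of f "Suc n"] inc_fixed_max[of f "Suc n" k]
      by (simp add: J_set_def)
  next
    case False
    then show ?thesis
      using permutes_fixed_max[of "Suc n" f] by (auto simp: J_set_def)
  qed
  then show ?thesis by blast
qed

text \<open>The maximum is fixed, or lies outside the occurrence, or belongs to it. The last case
  needs \<open>Suc k \<ge> 3\<close> and an odd length \<open>Suc n\<close>, that is, an even
  \<open>n\<close>.\<close>

lemma card_J_set_rec:
  assumes "2 \<le> k"
  shows "card (J_set (Suc k) (Suc n)) = card (J_set k n)
    + (\<Sum>m = 1..n. if 2 * m \<le> Suc n then card (D_set (Suc k) m) * card (J_set (Suc k) (Suc n - 2 * m)) else 0)
    + (if even n then card (D_set (Suc k) (n div 2)) else 0)"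
proof -
  let ?J = "J_set (Suc k) (Suc n)" and ?N = "Suc n"
  let ?F = "{\<alpha> \<in> ?J. \<alpha> ?N = ?N}" and ?S = "\<lambda>m. {\<alpha> \<in> ?J. \<alpha> ?N = m \<and> sep \<alpha> m ?N}"
    and ?R = "{\<alpha> \<in> ?J. \<alpha> ?N < ?N \<and> \<not> sep \<alpha> (\<alpha> ?N) ?N}"
  have range: "1 \<le> \<alpha> ?N" "\<alpha> ?N \<le> ?N" if "\<alpha> \<in> ?J" for \<alpha>
    using permutes_range[OF J_setD(1)[OF that], of ?N] by auto
  have fin: "finite ?F" "finite (\<Union>m\<in>{1..n}. ?S m)" "finite ?R" "finite (?S m)" for m
    by (rule finite_subset[OF _ finite_J_set[of "Suc k" ?N]]; blast)+
  have J_eq: "?J = ?F \<union> (\<Union>m\<in>{1..n}. ?S m) \<union> ?R"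
  proof -
    have "\<alpha> ?N = ?N \<or> \<alpha> ?N \<in> {1..n} \<and> \<alpha> ?N < ?N" if "\<alpha> \<in> ?J" for \<alpha>
      using range[OF that] by auto
    then show ?thesis by blast
  qed
  have "(?F \<union> (\<Union>m\<in>{1..n}. ?S m)) \<inter> ?R = {}" "?F \<inter> (\<Union>m\<in>{1..n}. ?S m) = {}" by auto
  then have "card ?J = card ?F + card (\<Union>m\<in>{1..n}. ?S m) + card ?R"
    by (subst J_eq) (simp only: card_Un_disjoint fin finite_UnI)
  moreover have "card (\<Union>m\<in>{1..n}. ?S m) = (\<Sum>m = 1..n. card (?S m))"
    using fin(4) by (intro card_UN_disjoint) auto
  moreover have "(\<Sum>m = 1..n. card (?S m)) =
      (\<Sum>m = 1..n. if 2 * m \<le> Suc n then card (D_set (Suc k) m) * card (J_set (Suc k) (Suc n - 2 * m)) else 0)"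
    using card_J_sep[of _ ?N "Suc k"] by (intro sum.cong) auto
  ultimately show ?thesis
    using card_J_not_sep[of "Suc k" ?N] assms by (simp add: J_set_fixed_last)
qed

lemma J_set_0: "J_set k 0 = {}"
proof -
  have "occ f {} = {}" for f by (auto simp: occ_def)
  then show ?thesis by (simp add: J_set_def)
qed

text \<open>The first two entries of a 132 are increasing, so subsets of these two positions give
  increasing sets of sizes 0, 1 and 2.\<close>

lemma J_set_le_2:
  assumes "k \<le> 2"
  shows "J_set k n = {}"
proof -
  have "inc k \<alpha> {1..n}" if "(a, b, c) \<in> occ \<alpha> {1..n}" for \<alpha> a b c
  proof -
    have mono: "strict_mono_on S \<alpha>" if "S \<subseteq> {a, b}" for S
    proof (rule strict_mono_onI)
      fix r s assume "r \<in> S" "s \<in> S" "r < s"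
      with \<open>S \<subseteq> {a, b}\<close> have "r \<in> {a, b}" "s \<in> {a, b}" "r < s" by auto
      then show "\<alpha> r < \<alpha> s" using \<open>(a, b, c) \<in> occ \<alpha> {1..n}\<close> by (auto simp: occ_def)
    qed
    have ab: "card {a, b} = 2" "{a, b} \<subseteq> {1..n}"
      using that by (auto simp: occ_def)
    obtain S where "S \<subseteq> {a, b}" "card S = k" "finite S"
      using obtain_subset_with_card_n[of k "{a, b}"] assms ab(1) by auto
    then show ?thesis unfolding inc_def using mono ab(2) by (intro exI[of _ S]) auto
  qed
  then show ?thesis unfolding J_set_def
    by (auto simp: card_1_singleton_iff) 
qed

subsection \<open>Generating functions\<close>

definition C_gf :: "nat \<Rightarrow> real fps" where
  "C_gf k = Abs_fps (\<lambda>n. real (card (C_set k n)))"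

lemma C_gf_0: "C_gf 0 = 0"
  by (simp add: C_gf_def C_set_0 fps_eq_iff)

lemma D_gf_eq: "Abs_fps (\<lambda>n. real (card (D_set (Suc k) n))) = fps_X * C_gf k"
proof (rule fps_ext)
  fix n
  show "Abs_fps (\<lambda>n. real (card (D_set (Suc k) n))) $ n = (fps_X * C_gf k) $ n"
    by (cases n) (simp_all add: C_gf_def D_set_0 D_set_Suc)
qed

lemma C_gf_rec: "C_gf (Suc k) = 1 + fps_X * C_gf k * C_gf (Suc k)"
proof (rule fps_ext)
  fix n
  let ?d = "\<lambda>n. real (card (D_set (Suc k) n))" and ?c = "\<lambda>n. real (card (C_set (Suc k) n))"
  show "C_gf (Suc k) $ n = (1 + fps_X * C_gf k * C_gf (Suc k)) $ n"
  proof (cases "n = 0")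
    case True
    then show ?thesis by (simp add: C_gf_def card_C_set_Suc_0)
  next
    case False
    then have "?c n = (\<Sum>m = 1..n. ?d m * ?c (n - m))"
      using card_C_set_rec[of n "Suc k"] by simp
    \<comment> \<open>The term for \<open>m = 0\<close> vanishes because \<open>D_set\<close> is
      empty there, which completes the Cauchy product.\<close>
    also have "\<dots> = (\<Sum>m = 0..n. ?d m * ?c (n - m))"
      by (intro sum.mono_neutral_left) (auto simp: D_set_0 not_less_eq_eq)
    also have "\<dots> = (fps_X * C_gf k * C_gf (Suc k)) $ n"
      unfolding D_gf_eq[symmetric] by (simp add: fps_mult_nth C_gf_def)
    finally show ?thesis using False by (simp add: C_gf_def)
  qed
qed

text \<open>This is C_k(x^2): the blocks \<sigma> and \<open>inv \<sigma>\<close> occur in pairs, so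
  each point of \<sigma> has weight x^2.\<close>

definition C2_gf :: "nat \<Rightarrow> real fps" where
  "C2_gf k = C_gf k oo fps_X ^ 2"

lemma C2_gf_0: "C2_gf 0 = 0"
  by (simp add: C2_gf_def C_gf_0)

lemma X2_C2_gf: "fps_X ^ 2 * C2_gf k = (fps_X * C_gf k) oo fps_X ^ 2"
  unfolding C2_gf_def by (subst fps_compose_mult_distrib) (simp_all add: fps_X_power_nth)

lemma C2_gf_rec: "C2_gf (Suc k) = 1 + fps_X ^ 2 * C2_gf k * C2_gf (Suc k)"
proof -
  have "C2_gf (Suc k) = (1 + fps_X * C_gf k * C_gf (Suc k)) oo fps_X ^ 2"
    unfolding C2_gf_def by (subst C_gf_rec) simp
  also have "\<dots> = 1 + ((fps_X * C_gf k) oo fps_X ^ 2) * C2_gf (Suc k)"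
    by (simp add: fps_compose_add_distrib fps_compose_mult_distrib C2_gf_def)
  finally show ?thesis by (simp add: X2_C2_gf)
qed

lemma X2_C2_gf_nth:
  "(fps_X ^ 2 * C2_gf k) $ n = (if even n then real (card (D_set (Suc k) (n div 2))) else 0)"
  unfolding X2_C2_gf D_gf_eq[symmetric] fps_nth_compose_X_power by simp

text \<open>Substitute \<open>i = 2 * m\<close>. The assumption removes \<open>m = 0\<close>, and
  \<open>2 * m \<le> Suc n\<close> with \<open>m \<ge> 1\<close> already implies
  \<open>m \<le> n\<close>.\<close>

lemma sum_even_indices:
  fixes f :: "nat \<Rightarrow> nat \<Rightarrow> real"
  assumes "\<And>j. f 0 j = 0"
  shows "(\<Sum>i = 0..Suc n. if even i then f (i div 2) (Suc n - i) else 0)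
    = (\<Sum>m = 1..n. if 2 * m \<le> Suc n then f m (Suc n - 2 * m) else 0)"
proof -
  have "(\<Sum>i = 0..Suc n. if even i then f (i div 2) (Suc n - i) else 0)
      = (\<Sum>i \<in> {i \<in> {0..Suc n}. even i \<and> i \<noteq> 0}. f (i div 2) (Suc n - i))"
    using assms by (intro sum.mono_neutral_cong_right) (auto intro: gr0I)
  also have "\<dots> = (\<Sum>m \<in> {m \<in> {1..n}. 2 * m \<le> Suc n}. f m (Suc n - 2 * m))"
    by (rule sum.reindex_bij_witness[where i = "\<lambda>m. 2 * m" and j = "\<lambda>i. i div 2"])
      (auto elim!: evenE)
  also have "\<dots> = (\<Sum>m = 1..n. if 2 * m \<le> Suc n then f m (Suc n - 2 * m) else 0)"
    by (rule sum.inter_filter) simp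
  finally show ?thesis .
qed

text \<open>The summands are the three cases of \<open>card_J_set_rec\<close>; the extra factor
  \<open>fps_X\<close> in the last one stands for the inserted fixed point.\<close>

lemma J_gf_rec:
  assumes "2 \<le> k"
  shows "J_gf (Suc k) = fps_X * J_gf k + fps_X ^ 2 * C2_gf k * J_gf (Suc k) + fps_X * (fps_X ^ 2 * C2_gf k)"
proof (rule fps_ext)
  fix N
  show "J_gf (Suc k) $ N
    = (fps_X * J_gf k + fps_X ^ 2 * C2_gf k * J_gf (Suc k) + fps_X * (fps_X ^ 2 * C2_gf k)) $ N"
  proof (cases N)
    case 0
    have "(fps_X ^ 2 * C2_gf k) $ 0 = 0" by (simp add: X2_C2_gf_nth D_set_0)
    then show ?thesis using 0 by (simp add: J_gf_def J_count_eq J_set_0)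
  next
    case (Suc n)
    define d where "d = (\<lambda>n. real (card (D_set (Suc k) n)))"
    define j where "j = (\<lambda>n. real (card (J_set (Suc k) n)))"
    have "(fps_X ^ 2 * C2_gf k * J_gf (Suc k)) $ N
        = (\<Sum>i = 0..Suc n. if even i then d (i div 2) * j (Suc n - i) else 0)"
      unfolding fps_mult_nth[of "fps_X ^ 2 * C2_gf k"] X2_C2_gf_nth
      by (simp only: Suc d_def j_def J_gf_def J_count_eq fps_nth_Abs_fps if_distrib[of "\<lambda>x. x * _"] mult_zero_left)
    also have "\<dots> = (\<Sum>m = 1..n. if 2 * m \<le> Suc n then d m * j (Suc n - 2 * m) else 0)"
      by (rule sum_even_indices) (simp add: d_def D_set_0)
    also have "\<dots> = real (\<Sum>m = 1..n. if 2 * m \<le> Suc n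
        then card (D_set (Suc k) m) * card (J_set (Suc k) (Suc n - 2 * m)) else 0)"
      unfolding of_nat_sum by (intro sum.cong) (auto simp: d_def j_def)
    finally show ?thesis
      using card_J_set_rec[OF assms, of n]
      by (simp add: Suc J_gf_def J_count_eq X2_C2_gf_nth)
  qed
qed

lemma J_gf_le_2: "k \<le> 2 \<Longrightarrow> J_gf k = 0"
  by (simp add: J_gf_def J_count_eq J_set_le_2 fps_eq_iff)

subsection \<open>Chebyshev polynomials\<close>

lemma Cheb_U_eqI:
  assumes "\<And>\<theta>. sin \<theta> \<noteq> 0 \<Longrightarrow> poly p (cos \<theta>) = sin (real (r + 1) * \<theta>) / sin \<theta>"
  shows "Cheb_U r = p"
  using assms poly_Cheb_U_cos by (intro Cheb_U_unique[of _ r]) auto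

lemma Cheb_U_0: "Cheb_U 0 = 1"
  by (rule Cheb_U_eqI) simp

lemma Cheb_U_1: "Cheb_U 1 = [:0, 2:]"
  by (rule Cheb_U_eqI) (simp add: sin_double)

text \<open>This is U_(r+2)(t) = 2t U_(r+1)(t) - U_r(t), obtained from the addition formulas for the
  sine.\<close>

lemma Cheb_U_rec: "Cheb_U (r + 2) = pCons 0 (smult 2 (Cheb_U (r + 1))) - Cheb_U r"
proof (rule Cheb_U_eqI)
  fix \<theta> :: real assume \<theta>: "sin \<theta> \<noteq> 0"
  have "real (r + 3) * \<theta> = real (r + 2) * \<theta> + \<theta>" "real (r + 1) * \<theta> = real (r + 2) * \<theta> - \<theta>"
    by (simp_all add: algebra_simps)
  then have "sin (real (r + 3) * \<theta>) = 2 * cos \<theta> * sin (real (r + 2) * \<theta>) - sin (real (r + 1) * \<theta>)"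
    by (simp only: sin_add sin_diff) simp
  moreover have "r + 2 + 1 = r + 3" "r + 1 + 1 = r + 2" by simp_all
  ultimately show "poly (pCons 0 (smult 2 (Cheb_U (r + 1))) - Cheb_U r) (cos \<theta>)
      = sin (real (r + 2 + 1) * \<theta>) / sin \<theta>"
    by (simp only: poly_diff poly_pCons poly_smult poly_Cheb_U_cos[OF \<theta>]) (simp add: diff_divide_distrib)
qed

section \<open>Chebyshev polynomials at 1/(2x) and telescoping\<close>

lemma U_at_0: "U_at 0 = 1"
  by (simp add: U_at_def Cheb_U_0)

lemma X_half_inverse: "fls_X * (2 * (1 / (2 * fls_X))) = (1 :: real fls)"
proof -
  have "x * (2 * (1 / (2 * x))) = 1" if "x \<noteq> 0" for x :: "real fls"
    using that by (simp add: field_simps)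
  then show ?thesis using fls_X_nonzero by blast
qed

lemma X_U_at_1: "fls_X * U_at 1 = 1"
  unfolding U_at_def Cheb_U_1
  using X_half_inverse by (simp only: map_poly_pCons poly_pCons map_poly_0 poly_0 fls_const_0 fls_const_numeral mult_zero_right add_0 add_0_right mult.commute[of _ 2])

text \<open>At t = 1/(2x) the factor 2t of the Chebyshev recurrence is 1/x; multiplying by
  \<open>fls_X\<close> clears it.\<close>

lemma X_U_at_rec: "fls_X * U_at (r + 2) = U_at (r + 1) - fls_X * U_at r"
proof -
  have map: "map_poly fls_const (pCons 0 (smult 2 p) - q)
      = pCons 0 (smult 2 (map_poly fls_const p)) - map_poly fls_const q" for p q :: "real poly"
    by (rule poly_eqI) (simp add: coeff_map_poly coeff_pCons fls_const_mult_const fls_minus_const flip: fls_const_numeral split: nat.split)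
  show ?thesis
    unfolding U_at_def Cheb_U_rec map poly_diff poly_pCons poly_smult
  proof -
    have "x * (0 + y * (2 * P) - Q) = (x * (2 * y)) * P - x * Q" for x y P Q :: "real fls"
      by (simp add: algebra_simps)
    then show "fls_X * (0 + 1 / (2 * fls_X) * (2 * poly (map_poly fls_const (Cheb_U (r + 1))) (1 / (2 * fls_X)))
        - poly (map_poly fls_const (Cheb_U r)) (1 / (2 * fls_X)))
      = poly (map_poly fls_const (Cheb_U (r + 1))) (1 / (2 * fls_X))
        - fls_X * poly (map_poly fls_const (Cheb_U r)) (1 / (2 * fls_X))"
      by (simp only: X_half_inverse mult_1)
  qed
qed

lemma C2_gf_fls_rec:
  "(1 - fls_X ^ 2 * fps_to_fls (C2_gf k)) * fps_to_fls (C2_gf (Suc k)) = 1"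
  using arg_cong[OF C2_gf_rec[of k], of fps_to_fls]
  by (simp add: fls_times_fps_to_fls fps_to_fls_power algebra_simps)

lemma C2_gf_U_at: "U_at (Suc k) * fps_to_fls (C2_gf (Suc k)) * fls_X = U_at k"
proof (induction k)
  case 0
  have "fps_to_fls (C2_gf 1) = 1" using C2_gf_fls_rec[of 0] by (simp add: C2_gf_0)
  then show ?case using X_U_at_1 by (simp add: U_at_0 mult.commute)
next
  case (Suc k)
  let ?c = "fps_to_fls (C2_gf (Suc k))" and ?c' = "fps_to_fls (C2_gf (Suc (Suc k)))"
  \<comment> \<open>The induction hypothesis rewrites \<open>U_at k\<close> as a multiple of
    \<open>U_at (Suc k)\<close>; the factor that appears is the inverse of
    \<open>?c'\<close>.\<close>
  have "fls_X * U_at (Suc (Suc k)) = U_at (Suc k) * (1 - fls_X ^ 2 * ?c)"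
    using X_U_at_rec[of k] Suc.IH[symmetric] by (simp add: algebra_simps power2_eq_square)
  then have "fls_X * U_at (Suc (Suc k)) * ?c' = U_at (Suc k) * ((1 - fls_X ^ 2 * ?c) * ?c')"
    by (simp only: mult.assoc)
  then show ?case by (simp only: C2_gf_fls_rec) (simp add: ac_simps)
qed

text \<open>By \<open>C2_gf_U_at\<close>, a zero at \<open>Suc k\<close> would give a zero at
  \<open>k\<close>.\<close>

lemma U_at_nonzero: "U_at k \<noteq> 0"
proof (induction k)
  case (Suc k)
  then show ?case using C2_gf_U_at[of k] by auto
qed (simp add: U_at_0)

text \<open>The recurrences for J and for U share the factor 1 - x^2 C(x^2). Eliminating it leaves a
  difference equation for the product of U and J.\<close>

lemma J_gf_U_at:
  "U_at (Suc (Suc (Suc k))) * fps_to_fls (J_gf (Suc (Suc (Suc k))))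
    = U_at (Suc (Suc k)) * fps_to_fls (J_gf (Suc (Suc k))) + fls_X * U_at (Suc k)"
proof -
  let ?u = "U_at (Suc k)" and ?u' = "U_at (Suc (Suc k))" and ?u'' = "U_at (Suc (Suc (Suc k)))"
  let ?c = "fps_to_fls (C2_gf (Suc (Suc k)))"
  let ?j = "fps_to_fls (J_gf (Suc (Suc k)))" and ?j' = "fps_to_fls (J_gf (Suc (Suc (Suc k))))"
  have u: "?u = ?u' * ?c * fls_X" by (rule C2_gf_U_at[symmetric])
  have "?j' = fls_X * ?j + fls_X ^ 2 * ?c * ?j' + fls_X * (fls_X ^ 2 * ?c)"
    using arg_cong[OF J_gf_rec[of "Suc (Suc k)"], of fps_to_fls]
    by (simp add: fls_times_fps_to_fls fps_to_fls_power)
  then have j': "(1 - fls_X ^ 2 * ?c) * ?j' = fls_X * ?j + fls_X * (fls_X ^ 2 * ?c)"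
    by (simp add: algebra_simps)
  have "fls_X * ?u'' = ?u' * (1 - fls_X ^ 2 * ?c)"
    using X_U_at_rec[of "Suc k"] u by (simp add: algebra_simps power2_eq_square)
  then have "fls_X * ?u'' * ?j' = ?u' * (fls_X * ?j + fls_X * (fls_X ^ 2 * ?c))"
    by (simp only: mult.assoc j')
  also have "\<dots> = fls_X * (?u' * ?j + fls_X * ?u)"
    unfolding u by (simp add: algebra_simps power2_eq_square)
  finally show ?thesis by (simp add: mult.assoc)
qed

theorem theorem4p6:
  fixes k :: nat
  assumes "k \<ge> 1"
  shows "fps_to_fls (J_gf k) = fls_X / U_at k * (\<Sum>j=1..k-2. U_at j)"
proof -
  \<comment> \<open>Cleared of the denominator, the claim follows by induction. Both sides vanish up
    to \<open>k = 2\<close>, where the sum is empty.\<close>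
  have "U_at k * fps_to_fls (J_gf k) = fls_X * (\<Sum>j=1..k-2. U_at j)"
  proof (induction k)
    case (Suc k)
    show ?case
    proof (cases "2 \<le> k")
      case True
      \<comment> \<open>With this \<open>i\<close>, the term added by \<open>J_gf_U_at\<close> has
        index \<open>Suc i\<close>, which is the new upper limit \<open>Suc k - 2\<close>.\<close>
      then obtain i where "k = Suc (Suc i)" by (metis add_2_eq_Suc le_Suc_ex)
      with Suc.IH J_gf_U_at[of i] show ?thesis by (simp add: distrib_left)
    qed (simp add: J_gf_le_2)
  qed (simp add: J_gf_le_2)
  with U_at_nonzero show ?thesis by (simp add: field_simps)
qed

end
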